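(* There is a constant $C>0$ such that for all $\nu\in(0,1]$, all $k\in\mathbb{Z}$ with $|k|\ge1$, all $\lambda\in\mathbb{R}$ and all $F\in L^2(I)$, if $w\in H^2(I)$ satisfies $$-\nu(\partial_y^2-k^2)w+ik(y-\lambda)w=F\ \text{ in } I,\qquad w(\pm1)=0,$$ then $$\nu^{1/6}|k|^{4/3}\|u\|_{L^2}+\nu^{1/6}|k|^{5/6}\|w\|_{L^1}+\nu^{2/3}|k|^{1/3}\|w'\|_{L^2}+(\nu k^2)^{1/3}\|w\|_{L^2}+|k|\,\|(y-\lambda)w\|_{L^2}\le C\|F\|_{L^2},$$ where $u=(\partial_y\varphi,-ik\varphi)$ and $\varphi$ is the solution of $(\partial_y^2-k^2)\varphi=w$ with $\varphi(\pm1)=0$.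
   Context: $I=(-1,1)$; functions are complex-valued; all norms are over $I$; $'$ denotes $d/dy$. *)

theory Defs
  imports "HOL-Analysis.Analysis"
begin

abbreviation I_interval :: "real set" ("\<I>") where
  "\<I> \<equiv> {-1<..<1}"

text \<open>Elements of the function spaces are representatives \<open>real \<Rightarrow> complex\<close>; their values
  outside the open interval never matter.\<close>

definition L2_space :: "(real \<Rightarrow> complex) set" ("L\<^sup>2") where
  "L\<^sup>2 = {f \<in> borel_measurable (lebesgue_on \<I>).
          integrable (lebesgue_on \<I>) (\<lambda>y. (norm (f y))\<^sup>2)}"

text \<open>The codomain is general because the norm is also applied to the vector field \<open>u\<close>, with values
  in \<open>complex \<times> complex\<close>, whose norm is the Hermitian one.\<close>

definition L2_norm :: "(real \<Rightarrow> 'a::real_normed_vector) \<Rightarrow> real" where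
  "L2_norm f = sqrt (LINT y|lebesgue_on \<I>. (norm (f y))\<^sup>2)"

definition L1_norm :: "(real \<Rightarrow> 'a::real_normed_vector) \<Rightarrow> real" where
  "L1_norm f = (LINT y|lebesgue_on \<I>. norm (f y))"

definition locally_integrable :: "(real \<Rightarrow> complex) \<Rightarrow> bool" where
  "locally_integrable f \<longleftrightarrow> (\<forall>K. compact K \<and> K \<subseteq> \<I> \<longrightarrow> integrable (lebesgue_on K) f)"

definition test_function :: "(real \<Rightarrow> real) \<Rightarrow> bool" where
  "test_function \<theta> \<longleftrightarrow>
     (\<forall>n y. (deriv ^^ n) \<theta> field_differentiable at y) \<and>
     compact (closure {y. \<theta> y \<noteq> 0}) \<and> closure {y. \<theta> y \<noteq> 0} \<subseteq> \<I>"

definition weak_deriv :: "(real \<Rightarrow> complex) \<Rightarrow> (real \<Rightarrow> complex) \<Rightarrow> bool" where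
  "weak_deriv f g \<longleftrightarrow> locally_integrable f \<and> locally_integrable g \<and>
     (\<forall>\<theta>. test_function \<theta> \<longrightarrow>
        (LINT y|lebesgue_on \<I>. deriv \<theta> y *\<^sub>R f y) = - (LINT y|lebesgue_on \<I>. \<theta> y *\<^sub>R g y))"

definition H2_space :: "(real \<Rightarrow> complex) set" ("H\<^sup>2") where
  "H\<^sup>2 = {f \<in> L\<^sup>2. \<exists>f'\<in>L\<^sup>2. \<exists>f''\<in>L\<^sup>2. weak_deriv f f' \<and> weak_deriv f' f''}"

text \<open>The boundary values of an \<open>H\<^sup>2\<close> function are those of its representative that is continuous
  up to the boundary.\<close>

definition zero_at_boundary :: "(real \<Rightarrow> complex) \<Rightarrow> bool" where
  "zero_at_boundary f \<longleftrightarrow>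
     (\<exists>g. continuous_on {-1..1} g \<and> (AE y in lebesgue_on \<I>. g y = f y) \<and> g (-1) = 0 \<and> g 1 = 0)"

end

theory Submission
  imports Defs "HOL-Computational_Algebra.Polynomial"
begin

text \<open>Write \<open>N\<close>, \<open>W\<close>, \<open>D\<close>, \<open>M\<close> for the \<open>L\<^sup>2\<close> norms of \<open>F\<close>, \<open>w\<close>, \<open>w'\<close>, \<open>(y - \<lambda>)w\<close>. Pairing the
  equation with \<open>w\<close> gives \<open>\<nu>D\<^sup>2 \<le> NW\<close>, pairing it with \<open>(y - \<lambda>)w\<close> gives
  \<open>|k|M\<^sup>2 \<le> NM + \<nu>DW\<close>, and integrating the derivative of \<open>(y - \<lambda>)|w|\<^sup>2\<close> gives \<open>W\<^sup>2 \<le> 2MD\<close>. These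
  three inequalities alone bound \<open>W\<close>, \<open>D\<close>, \<open>M\<close> by \<open>N\<close> with the stated powers. The \<open>L\<^sup>1\<close> norm follows by
  Cauchy-Schwarz with the weight \<open>\<delta>\<^sup>2 + (y - \<lambda>)\<^sup>2\<close>, where \<open>\<delta> = (\<nu>/|k|)\<^sup>1\<^sup>/\<^sup>3\<close>, and the velocity from
  \<open>\<parallel>u\<parallel>\<^sup>2 \<le> \<parallel>w\<parallel>\<^sub>1 sup |\<phi>|\<close> and \<open>|k| |\<phi>|\<^sup>2 \<le> \<parallel>u\<parallel>\<^sup>2\<close>. The integrations by parts are justified by passing to
  absolutely continuous representatives.\<close>


subsection \<open>Absolutely continuous functions on the interval\<close>

text \<open>The critical point \<lambda> may lie inside the interval, outside it or at an endpoint,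
  so y - \<lambda> may change sign. The integrals of (y - \<lambda>)|w|^2 and (y - \<lambda>)|w'|^2
  therefore have no sign, but they are real: the real part of the first pairing and the imaginary
  part of the second do not see them, and no case distinction on \<lambda> arises. The length
  \<delta> is the width of the critical layer, where diffusion \<nu>/\<delta>^2 balances transport
  |k|\<delta>; there M scales like \<delta>W and D like W/\<delta>. The velocity is estimated
  through the L1 norm because the direct bound |k| ||u|| <= W, combined with the estimate of W,
  would lose a factor (\<nu>k^2)^(-1/6). On the analytic side the data are weak derivatives, known
  only through their action on smooth compactly supported functions. Reaching absolutely continuous
  representatives requires the du Bois-Reymond lemma, and this in turn a supply of test functions,
  which is built from exp(-c/x).\<close>

abbreviation (input) leb_I :: "real measure" where
  "leb_I \<equiv> lebesgue_on \<I>"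

lemma finite_measure_leb_I: "finite_measure leb_I"
  by (rule finite_measure_lebesgue_on) simp

interpretation leb_I: finite_measure leb_I
  by (rule finite_measure_leb_I)

interpretation leb_I_pair: pair_sigma_finite leb_I leb_I ..

lemma integrable_leb_I_iff:
  fixes f :: "real \<Rightarrow> 'a :: {banach, second_countable_topology}"
  shows "integrable leb_I f \<longleftrightarrow> integrable lebesgue (\<lambda>x. indicator \<I> x *\<^sub>R f x)"
  by (rule integrable_restrict_space) simp

lemma integral_leb_I:
  fixes f :: "real \<Rightarrow> 'a :: {banach, second_countable_topology}"
  shows "integral\<^sup>L leb_I f = integral\<^sup>L lebesgue (\<lambda>x. indicator \<I> x *\<^sub>R f x)"
  by (rule integral_restrict_space) simp

lemma AE_leb_I_iff: "(AE x in leb_I. P x) \<longleftrightarrow> (AE x in lebesgue. x \<in> \<I> \<longrightarrow> P x)"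
  by (rule AE_restrict_space_iff) simp

lemma AE_leb_I_neq: "AE x in leb_I. x \<noteq> c"
  unfolding AE_leb_I_iff by (rule AE_mp[OF AE_completion[OF AE_lborel_singleton[of c]]]) auto

lemma borel_measurable_leb_I_continuous:
  fixes f :: "real \<Rightarrow> 'a :: {euclidean_space}"
  assumes "continuous_on {-1..1} f"
  shows "f \<in> borel_measurable leb_I"
  by (rule continuous_imp_measurable_on_sets_lebesgue)
     (auto intro: continuous_on_subset[OF assms])

lemma borel_measurable_leb_I_borel:
  "f \<in> borel_measurable borel \<Longrightarrow> f \<in> borel_measurable leb_I"
  by (intro measurable_restrict_space1 measurable_completion) simp

text \<open>Continuity up to the endpoints gives boundedness by compactness. Products of an
  absolutely continuous function with the derivative of another one have this form.\<close>

lemma bounded_times_integrable_leb_I: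
  fixes f g :: "real \<Rightarrow> 'a :: {real_normed_algebra, euclidean_space}"
  assumes "continuous_on {-1..1} f" "integrable leb_I g"
  shows "integrable leb_I (\<lambda>x. f x * g x)"
proof -
  have "bounded (f ` {-1..1})"
    by (intro compact_imp_bounded compact_continuous_image assms) simp
  then obtain B where B: "\<And>x. x \<in> {-1..1} \<Longrightarrow> norm (f x) \<le> B"
    unfolding bounded_iff by blast
  have "norm (f x * g x) \<le> norm (B * norm (g x))" if "x \<in> \<I>" for x
  proof -
    have "norm (f x * g x) \<le> norm (f x) * norm (g x)" by (rule norm_mult_ineq)
    also have "\<dots> \<le> B * norm (g x)" using B[of x] that by (intro mult_right_mono) auto
    finally show ?thesis by simp
  qed
  then have bound: "AE x in leb_I. norm (f x * g x) \<le> norm (B * norm (g x))"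
    by (intro AE_I2) simp
  have int: "integrable leb_I (\<lambda>x. B * norm (g x))" using assms(2) by simp
  have meas: "(\<lambda>x. f x * g x) \<in> borel_measurable leb_I"
    using borel_measurable_leb_I_continuous[OF assms(1)] borel_measurable_integrable[OF assms(2)]
    by (rule borel_measurable_times)
  show ?thesis
    by (rule Bochner_Integration.integrable_bound[OF int meas bound])
qed

lemma integrable_leb_I_continuous:
  fixes f :: "real \<Rightarrow> 'a :: {real_normed_algebra_1, euclidean_space}"
  assumes "continuous_on {-1..1} f"
  shows "integrable leb_I f"
  using bounded_times_integrable_leb_I[OF assms, of "\<lambda>_. 1"] by simp

text \<open>Fubini on the square, split along its diagonal.\<close>

lemma Fubini_indefinite_integrals:
  fixes p q :: "real \<Rightarrow> complex"
  assumes [measurable]: "integrable leb_I p" "integrable leb_I q"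
  shows "(LINT t|leb_I. p t * (LINT s|leb_I. indicator {..t} s *\<^sub>R q s))
       + (LINT t|leb_I. q t * (LINT s|leb_I. indicator {..t} s *\<^sub>R p s))
       = (LINT t|leb_I. p t) * (LINT t|leb_I. q t)"
proof -
  have [measurable]: "(\<lambda>x. x) \<in> borel_measurable leb_I"
    by (rule borel_measurable_leb_I_borel) simp
  have meas [measurable]: "fst \<in> borel_measurable (leb_I \<Otimes>\<^sub>M leb_I)"
      "snd \<in> borel_measurable (leb_I \<Otimes>\<^sub>M leb_I)"
    using measurable_compose[OF measurable_fst \<open>(\<lambda>x. x) \<in> borel_measurable leb_I\<close>]
      measurable_compose[OF measurable_snd \<open>(\<lambda>x. x) \<in> borel_measurable leb_I\<close>] by auto
  have sets: "A \<in> sets borel \<Longrightarrow> (\<lambda>s. indicator A s :: real) \<in> borel_measurable leb_I" for A :: "real set"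
    by (intro borel_measurable_leb_I_borel) simp
  have int: "integrable leb_I (\<lambda>s. indicator A s *\<^sub>R f s)" if "A \<in> sets borel" "integrable leb_I f"
    for A and f :: "real \<Rightarrow> complex"
    using that sets by (intro Bochner_Integration.integrable_bound[OF that(2)]) (auto simp: indicator_def)
  \<comment> \<open>The part of \<open>p t * q s\<close> above the diagonal; it is dominated by the
    full product, hence integrable on the square.\<close>
  define f where "f t s = p t * (indicator {t<..} s *\<^sub>R q s)" for t s
  have f_meas: "case_prod f \<in> borel_measurable (leb_I \<Otimes>\<^sub>M leb_I)"
  proof -
    have "case_prod f = (\<lambda>z. p (fst z) * ((if fst z < snd z then 1 else 0) *\<^sub>R q (snd z)))"
      by (auto simp: f_def fun_eq_iff)
    also have "\<dots> \<in> borel_measurable (leb_I \<Otimes>\<^sub>M leb_I)" by measurable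
    finally show ?thesis .
  qed
  have pq: "integrable (leb_I \<Otimes>\<^sub>M leb_I) (\<lambda>z. p (fst z) * q (snd z))"
    by (rule leb_I_pair.Fubini_integrable) (use assms in \<open>auto simp: norm_mult\<close>)
  have f_int: "integrable (leb_I \<Otimes>\<^sub>M leb_I) (case_prod f)"
    by (rule Bochner_Integration.integrable_bound[OF pq f_meas])
       (auto simp: f_def indicator_def norm_mult)
  have q_split: "(LINT s|leb_I. q s) = (LINT s|leb_I. indicator {..t} s *\<^sub>R q s) + (LINT s|leb_I. indicator {t<..} s *\<^sub>R q s)" for t
  proof -
    have "(LINT s|leb_I. q s) = (LINT s|leb_I. indicator {..t} s *\<^sub>R q s + indicator {t<..} s *\<^sub>R q s)"
      by (intro Bochner_Integration.integral_cong) (auto simp: indicator_def)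
    then show ?thesis using int[of _ q] assms by simp
  qed
  have f_inner: "(LINT s|leb_I. f t s) = p t * (LINT s|leb_I. indicator {t<..} s *\<^sub>R q s)" for t
    unfolding f_def by (rule integral_mult_right_zero)
  have int_gt: "integrable leb_I (\<lambda>t. p t * (LINT s|leb_I. indicator {t<..} s *\<^sub>R q s))"
    using leb_I_pair.integrable_fst'[OF f_int] by (simp add: f_inner)
  have int_le: "integrable leb_I (\<lambda>t. p t * (LINT s|leb_I. indicator {..t} s *\<^sub>R q s))"
  proof -
    have "integrable leb_I (\<lambda>t. p t * (LINT s|leb_I. q s) - p t * (LINT s|leb_I. indicator {t<..} s *\<^sub>R q s))"
      using int_gt assms by (intro Bochner_Integration.integrable_diff) auto
    also have "(\<lambda>t. p t * (LINT s|leb_I. q s) - p t * (LINT s|leb_I. indicator {t<..} s *\<^sub>R q s)) =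
        (\<lambda>t. p t * (LINT s|leb_I. indicator {..t} s *\<^sub>R q s))"
    proof
      fix t
      show "p t * (LINT s|leb_I. q s) - p t * (LINT s|leb_I. indicator {t<..} s *\<^sub>R q s) =
        p t * (LINT s|leb_I. indicator {..t} s *\<^sub>R q s)"
        unfolding q_split[of t] by (simp add: algebra_simps)
    qed
    finally show ?thesis .
  qed
  have "(LINT t|leb_I. p t * (LINT s|leb_I. indicator {t<..} s *\<^sub>R q s)) = (LINT t|leb_I. LINT s|leb_I. f t s)"
    by (simp add: f_inner)
  also have "\<dots> = (LINT s|leb_I. LINT t|leb_I. f t s)"
    by (rule leb_I_pair.Fubini_integral[OF f_int, symmetric])
  also have "\<dots> = (LINT s|leb_I. q s * (LINT t|leb_I. indicator {..s} t *\<^sub>R p t))"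
  proof (intro Bochner_Integration.integral_cong refl)
    fix s
    have "(LINT t|leb_I. f t s) = (LINT t|leb_I. q s * (indicator {..s} t *\<^sub>R p t))"
    proof (rule Bochner_Integration.integral_cong_AE)
      show "(\<lambda>t. f t s) \<in> borel_measurable leb_I"
      proof -
        have "(\<lambda>t. f t s) = (\<lambda>t. p t * (indicator {..<s} t *\<^sub>R q s))"
          by (auto simp: f_def indicator_def)
        also have "\<dots> \<in> borel_measurable leb_I" using sets[of "{..<s}"] by measurable
        finally show ?thesis .
      qed
      show "(\<lambda>t. q s * indicat_real {..s} t *\<^sub>R p t) \<in> borel_measurable leb_I"
        using int[of "{..s}" p] assms by (intro borel_measurable_integrable integrable_mult_right) auto
      \<comment> \<open>Read as a condition on \<open>t\<close>, the half-line is the open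
        \<open>{..<s}\<close>; it differs from the closed one in the claim at the single point
        \<open>s\<close>.\<close>
      show "AE t in leb_I. f t s = q s * indicat_real {..s} t *\<^sub>R p t"
        using AE_leb_I_neq[of s] by eventually_elim (auto simp: f_def indicator_def)
    qed
    also have "\<dots> = q s * (LINT t|leb_I. indicator {..s} t *\<^sub>R p t)"
      by (rule integral_mult_right_zero)
    finally show "(LINT t|leb_I. f t s) = q s * (LINT t|leb_I. indicator {..s} t *\<^sub>R p t)" .
  qed
  finally have *: "(LINT t|leb_I. p t * (LINT s|leb_I. indicator {t<..} s *\<^sub>R q s)) =
     (LINT s|leb_I. q s * (LINT t|leb_I. indicator {..s} t *\<^sub>R p t))" .
  have "(LINT t|leb_I. p t) * (LINT t|leb_I. q t) = (LINT t|leb_I. p t * (LINT s|leb_I. q s))" by simp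
  also have "\<dots> = (LINT t|leb_I. p t * (LINT s|leb_I. indicator {..t} s *\<^sub>R q s) + p t * (LINT s|leb_I. indicator {t<..} s *\<^sub>R q s))"
    by (intro Bochner_Integration.integral_cong refl) (metis q_split distrib_left)
  also have "\<dots> = (LINT t|leb_I. p t * (LINT s|leb_I. indicator {..t} s *\<^sub>R q s)) + (LINT t|leb_I. p t * (LINT s|leb_I. indicator {t<..} s *\<^sub>R q s))"
    using int_le int_gt by (rule Bochner_Integration.integral_add)
  finally show ?thesis using * by simp
qed

section \<open>Indefinite integrals and the product rule\<close>

text \<open>Absolute continuity on the closed interval, with \<open>g\<close> as almost everywhere
  derivative, encoded by the fundamental theorem of calculus. All increments are integrals against
  one fixed measure, which suits Fubini and changes of \<open>g\<close> on null sets, and the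
  endpoints are included, so that boundary values are actual values of \<open>f\<close>.\<close>

definition AC :: "(real \<Rightarrow> complex) \<Rightarrow> (real \<Rightarrow> complex) \<Rightarrow> bool" where
  "AC f g \<longleftrightarrow> integrable leb_I g \<and>
     (\<forall>y\<in>{-1..1}. f y - f (-1) = (LINT t|leb_I. indicator {..y} t *\<^sub>R g t))"

lemma AC_integrable: "AC f g \<Longrightarrow> integrable leb_I g"
  by (simp add: AC_def)

lemma integrable_indicator_leb_I:
  fixes g :: "real \<Rightarrow> complex"
  assumes "integrable leb_I g"
  shows "integrable leb_I (\<lambda>t. indicator {..y::real} t *\<^sub>R g t)"
proof -
  have "(\<lambda>s. indicator {..y} s :: real) \<in> borel_measurable leb_I"
    by (intro borel_measurable_leb_I_borel) simp
  then show ?thesis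
    using assms by (intro Bochner_Integration.integrable_bound[OF assms]) (auto simp: indicator_def)
qed

text \<open>Gives access to the gauge integral, for which continuity of indefinite integrals and the
  classical fundamental theorem are at hand.\<close>

lemma AC_has_integral_iff:
  "AC f g \<longleftrightarrow> integrable leb_I g \<and> (\<forall>y\<in>{-1..1}. (g has_integral (f y - f (-1))) {-1..y})"
proof -
  have *: "(g has_integral (LINT t|leb_I. indicator {..y} t *\<^sub>R g t)) {-1..y}"
    if "integrable leb_I g" "y \<in> {-1..1}" for y
  proof -
    have "((\<lambda>t. indicator {..y} t *\<^sub>R g t) has_integral (LINT t|leb_I. indicator {..y} t *\<^sub>R g t)) \<I>"
      by (rule has_integral_integral_lebesgue_on) (simp_all add: that integrable_indicator_leb_I)
    then have "((\<lambda>t. if t \<in> \<I> then indicator {..y} t *\<^sub>R g t else 0) has_integral (LINT t|leb_I. indicator {..y} t *\<^sub>R g t)) UNIV"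
      by (simp only: has_integral_restrict_UNIV)
    \<comment> \<open>The two integrands differ at most at the endpoints -1 and 1.\<close>
    then have "((\<lambda>t. if t \<in> {-1..y} then g t else 0) has_integral (LINT t|leb_I. indicator {..y} t *\<^sub>R g t)) UNIV"
      by (rule has_integral_spike[of "{-1,1}", rotated 2]) (use that in auto)
    then show ?thesis by (simp only: has_integral_restrict_UNIV)
  qed
  show ?thesis
    unfolding AC_def
  proof (intro conj_cong refl ball_cong)
    fix y assume "integrable leb_I g" "y \<in> {-1..1::real}"
    from *[OF this] show "(f y - f (-1) = (LINT t|leb_I. indicator {..y} t *\<^sub>R g t)) = (g has_integral f y - f (-1)) {-1..y}"
      by (metis has_integral_unique)
  qed
qed

lemma AC_continuous_on:
  assumes "AC f g"
  shows "continuous_on {-1..1} f"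
proof -
  have "g integrable_on {-1..1}"
    using assms unfolding AC_has_integral_iff by (metis atLeastAtMost_iff has_integral_integrable neg_le_iff_le order_refl one_le_numeral zero_le_one  order_trans neg_le_0_iff_le)
  then have "continuous_on {-1..1} (\<lambda>y. f (-1) + integral {-1..y} g)"
    by (intro continuous_intros indefinite_integral_continuous_1)
  moreover have "f (-1) + integral {-1..y} g = f y" if "y \<in> {-1..1}" for y
    using assms that unfolding AC_has_integral_iff by (metis add.commute diff_add_cancel integral_unique)
  ultimately show ?thesis
    by (rule continuous_on_eq)
qed

lemma AC_diff_eq:
  assumes "AC f g"
  shows "(LINT t|leb_I. g t) = f 1 - f (-1)"
proof -
  have "(LINT t|leb_I. g t) = (LINT t|leb_I. indicator {..1} t *\<^sub>R g t)"
    by (rule Bochner_Integration.integral_cong) auto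
  then show ?thesis using assms by (simp add: AC_def)
qed

lemma AC_cong_AE:
  assumes "AC f g" "AE x in leb_I. g x = g' x" "integrable leb_I g'"
  shows "AC f g'"
proof -
  have "(LINT t|leb_I. indicator {..y} t *\<^sub>R g t) = (LINT t|leb_I. indicator {..y} t *\<^sub>R g' t)" for y :: real
  proof (rule Bochner_Integration.integral_cong_AE)
    show "AE t in leb_I. indicat_real {..y} t *\<^sub>R g t = indicat_real {..y} t *\<^sub>R g' t"
      using assms(2) by eventually_elim simp
  qed (use assms in \<open>simp_all add: borel_measurable_integrable integrable_indicator_leb_I AC_integrable\<close>)
  then show ?thesis using assms unfolding AC_def by simp
qed

lemma AC_indefinite_integral:
  assumes "integrable leb_I g"
  shows "AC (\<lambda>y. LINT t|leb_I. indicator {..y} t *\<^sub>R g t) g"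
proof -
  have "(LINT t|leb_I. indicator {..-1} t *\<^sub>R g t) = 0"
    by (subst Bochner_Integration.integral_cong[OF refl, of _ _ "\<lambda>_. 0"]) (auto simp: indicator_def)
  then show ?thesis using assms by (simp add: AC_def)
qed

lemma AC_cnj:
  assumes "AC f g"
  shows "AC (\<lambda>y. cnj (f y)) (\<lambda>y. cnj (g y))"
  unfolding AC_def
proof (intro conjI ballI)
  show "integrable leb_I (\<lambda>y. cnj (g y))" using AC_integrable[OF assms] by simp
  fix y :: real assume "y \<in> {-1..1}"
  then have "cnj (f y) - cnj (f (-1)) = cnj (LINT t|leb_I. indicator {..y} t *\<^sub>R g t)"
    using assms by (simp add: AC_def flip: complex_cnj_diff)
  also have "\<dots> = (LINT t|leb_I. indicator {..y} t *\<^sub>R cnj (g t))"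
    by (subst Bochner_Integration.integral_cnj[symmetric]) simp
  finally show "cnj (f y) - cnj (f (-1)) = (LINT t|leb_I. indicator {..y} t *\<^sub>R cnj (g t))" .
qed

lemma AC_C1:
  assumes "\<And>y. y \<in> {-1..1} \<Longrightarrow> (f has_vector_derivative g y) (at y within {-1..1})"
    and "continuous_on {-1..1} g"
  shows "AC f g"
  unfolding AC_has_integral_iff
proof (intro conjI ballI integrable_leb_I_continuous assms(2))
  fix y :: real assume "y \<in> {-1..1}"
  then show "(g has_integral f y - f (- 1)) {- 1..y}"
    by (intro fundamental_theorem_of_calculus)
       (auto intro: has_vector_derivative_within_subset[OF assms(1)])
qed

text \<open>The source of every integration by parts below. Once f and g are written as initial
  value plus indefinite integral, P and Q, the only nontrivial part of the claim is that P(y)Q(y) is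
  the sum of the integrals of pQ and qP, which is Fubini split along the diagonal.\<close>

lemma AC_mult:
  assumes "AC f f'" "AC g g'"
  shows "AC (\<lambda>y. f y * g y) (\<lambda>y. f' y * g y + f y * g' y)"
proof -
  note cont = assms[THEN AC_continuous_on] and int = assms[THEN AC_integrable]
  have i1: "integrable leb_I (\<lambda>y. f' y * g y)"
    using bounded_times_integrable_leb_I[OF cont(2) int(1)] by (simp add: mult.commute)
  have i2: "integrable leb_I (\<lambda>y. f y * g' y)"
    by (rule bounded_times_integrable_leb_I[OF cont(1) int(2)])
  show ?thesis
    unfolding AC_def
  proof (intro conjI ballI)
    show "integrable leb_I (\<lambda>y. f' y * g y + f y * g' y)" using i1 i2 by simp
    fix y :: real assume y: "y \<in> {-1..1}"
    then have y_mem: "y \<in> {-1..y}" by simp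
    \<comment> \<open>Cutting the derivatives off at \<open>y\<close> turns integrals up to
      \<open>y\<close> into integrals over the whole interval, the form in which the Fubini identity
      is available.\<close>
    define p where "p t = indicator {..y} t *\<^sub>R f' t" for t
    define q where "q t = indicator {..y} t *\<^sub>R g' t" for t
    have pq: "integrable leb_I p" "integrable leb_I q"
      unfolding p_def q_def using int by (simp_all add: integrable_indicator_leb_I)
    define P where "P t = (LINT s|leb_I. indicator {..t} s *\<^sub>R p s)" for t
    define Q where "Q t = (LINT s|leb_I. indicator {..t} s *\<^sub>R q s)" for t
    have fP: "f t = f (-1) + P t" and gQ: "g t = g (-1) + Q t" if "t \<in> {-1..y}" for t
    proof -
      have "P t = (LINT s|leb_I. indicator {..t} s *\<^sub>R f' s)" "Q t = (LINT s|leb_I. indicator {..t} s *\<^sub>R g' s)"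
        unfolding P_def Q_def
        by (intro Bochner_Integration.integral_cong refl; use that in \<open>auto simp: p_def q_def indicator_def\<close>)+
      then have "f t - f (-1) = P t" "g t - g (-1) = Q t" using assms y that by (auto simp: AC_def)
      then show "f t = f (-1) + P t" "g t = g (-1) + Q t" by (metis add.commute diff_add_cancel)+
    qed
    have contP: "continuous_on {-1..1} P" and contQ: "continuous_on {-1..1} Q"
      unfolding P_def Q_def using pq by (auto intro!: AC_continuous_on AC_indefinite_integral)
    have iP: "integrable leb_I (\<lambda>t. q t * P t)" and iQ: "integrable leb_I (\<lambda>t. p t * Q t)"
      using bounded_times_integrable_leb_I[OF contP pq(2)] bounded_times_integrable_leb_I[OF contQ pq(1)]
      by (simp_all add: mult.commute)
    have PQ1: "P y = (LINT t|leb_I. p t)" "Q y = (LINT t|leb_I. q t)"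
      unfolding P_def Q_def p_def q_def
      by (intro Bochner_Integration.integral_cong refl; auto simp: indicator_def)+
    have "(LINT t|leb_I. indicator {..y} t *\<^sub>R (f' t * g t + f t * g' t)) =
          (LINT t|leb_I. (g (-1) * p t + f (-1) * q t) + (p t * Q t + q t * P t))"
    proof (intro Bochner_Integration.integral_cong refl)
      fix t assume "t \<in> space leb_I"
      then show "indicator {..y} t *\<^sub>R (f' t * g t + f t * g' t) = (g (-1) * p t + f (-1) * q t) + (p t * Q t + q t * P t)"
        using fP[of t] gQ[of t] by (auto simp: p_def q_def indicator_def algebra_simps)
    qed
    also have "\<dots> = g (-1) * P y + f (-1) * Q y + ((LINT t|leb_I. p t * Q t) + (LINT t|leb_I. q t * P t))"
      using pq iP iQ by (simp add: PQ1)
    also have "(LINT t|leb_I. p t * Q t) + (LINT t|leb_I. q t * P t) = P y * Q y"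
      unfolding PQ1 unfolding P_def Q_def by (rule Fubini_indefinite_integrals[OF pq])
    finally show "f y * g y - f (- 1) * g (- 1) = (LINT t|leb_I. indicator {..y} t *\<^sub>R (f' t * g t + f t * g' t))"
      unfolding fP[OF y_mem] gQ[OF y_mem] by (simp add: algebra_simps)
  qed
qed

subsection \<open>Smooth bump functions\<close>

text \<open>The classical flat function exp(-c/x), extended by 0. The polynomial in 1/x is carried
  along because differentiation produces such factors, so that the family is closed under
  it.\<close>

definition flat :: "real poly \<Rightarrow> real \<Rightarrow> real \<Rightarrow> real" where
  "flat p c x = (if x > 0 then poly p (1 / x) * exp (- (c / x)) else 0)"

lemma poly_times_exp_tendsto_0:
  fixes p :: "real poly"
  assumes "c > 0"
  shows "((\<lambda>t. poly p t * exp (- (c * t))) \<longlongrightarrow> 0) at_top"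
proof -
  have *: "((\<lambda>t. t ^ n * exp (- (c * t))) \<longlongrightarrow> 0) at_top" for n
  proof -
    have "filterlim (\<lambda>t. c * t) at_top at_top"
      using assms by (intro filterlim_tendsto_pos_mult_at_top[OF tendsto_const]) (auto simp: filterlim_ident)
    then have "((\<lambda>t. (c * t) ^ n / exp (c * t)) \<longlongrightarrow> 0) at_top"
      by (rule filterlim_compose[OF tendsto_power_div_exp_0])
    then have "((\<lambda>t. (1 / c ^ n) * ((c * t) ^ n / exp (c * t))) \<longlongrightarrow> 0) at_top"
      by (rule tendsto_mult_right_zero)
    then show ?thesis
      using assms by (simp add: exp_minus field_simps)
  qed
  have "((\<lambda>t. \<Sum>i\<le>degree p. coeff p i * (t ^ i * exp (- (c * t)))) \<longlongrightarrow> 0) at_top"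
    by (intro tendsto_null_sum tendsto_mult_right_zero *)
  then show ?thesis
    by (simp add: poly_altdef sum_distrib_right mult.assoc)
qed

lemma flat_tendsto_0:
  assumes "c > 0"
  shows "(flat p c \<longlongrightarrow> 0) (at 0)"
proof (rule filterlim_split_at)
  show "(flat p c \<longlongrightarrow> 0) (at_left 0)"
    by (rule tendsto_eventually) (auto simp: eventually_at_filter flat_def)
  have "((\<lambda>x. poly p (inverse x) * exp (- (c * inverse x))) \<longlongrightarrow> 0) (at_right 0)"
    by (rule filterlim_compose[OF poly_times_exp_tendsto_0[OF assms] filterlim_inverse_at_top_right])
  then show "(flat p c \<longlongrightarrow> 0) (at_right 0)"
    by (rule Lim_transform_eventually) (auto simp: eventually_at_filter flat_def field_simps)
qed

lemma flat_has_derivative: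
  assumes "c > 0"
  shows "(flat p c has_field_derivative flat (monom 1 2 * (smult c p - pderiv p)) c x) (at x)"
proof -
  consider "x > 0" | "x < 0" | "x = 0" by linarith
  then show ?thesis
  proof cases
    case 1
    have "((\<lambda>x. poly p (1 / x) * exp (- (c / x))) has_field_derivative
       poly (monom 1 2 * (smult c p - pderiv p)) (1 / x) * exp (- (c / x))) (at x)"
      using 1 by (auto intro!: derivative_eq_intros simp: poly_monom field_simps power2_eq_square)
    then have "(flat p c has_field_derivative
       poly (monom 1 2 * (smult c p - pderiv p)) (1 / x) * exp (- (c / x))) (at x)"
      by (rule DERIV_cong_ev[THEN iffD1, rotated 3])
         (use 1 eventually_nhds_in_open[of "{0<..}" x] in \<open>auto simp: flat_def elim: eventually_mono\<close>)
    then show ?thesis using 1 by (simp add: flat_def)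
  next
    case 2
    have "(flat p c has_field_derivative 0) (at x)"
      by (rule DERIV_cong_ev[THEN iffD1, rotated 3, OF DERIV_const[of 0]])
         (use 2 eventually_nhds_in_open[of "{..<0}" x] in \<open>auto simp: flat_def elim: eventually_mono\<close>)
    then show ?thesis using 2 by (simp add: flat_def)
  next
    case 3
    \<comment> \<open>Dividing by h multiplies the polynomial in 1/h by its variable, so the
      difference quotient at 0 is again a flat function and tends to 0. At h = 0 both sides are 0,
      as x / 0 = 0.\<close>
    have "(flat (pCons 0 p) c \<longlongrightarrow> 0) (at 0)"
      by (rule flat_tendsto_0[OF assms])
    also have "flat (pCons 0 p) c = (\<lambda>h. (flat p c (0 + h) - flat p c 0) / h)"
      by (auto simp: flat_def fun_eq_iff)
    finally show ?thesis using 3 by (simp add: DERIV_def flat_def)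
  qed
qed

text \<open>Smoothness comes without formulas for higher derivatives: the class contains the
  derivative of each of its members, so all iterated derivatives stay inside. Affine arguments allow
  flat functions starting at either end of an interval.\<close>

inductive_set flat_algebra :: "(real \<Rightarrow> real) set" where
  const: "(\<lambda>_. r) \<in> flat_algebra"
| flat: "c > 0 \<Longrightarrow> (\<lambda>x. flat p c (a + s * x)) \<in> flat_algebra"
| add: "f \<in> flat_algebra \<Longrightarrow> g \<in> flat_algebra \<Longrightarrow> (\<lambda>x. f x + g x) \<in> flat_algebra"
| mult: "f \<in> flat_algebra \<Longrightarrow> g \<in> flat_algebra \<Longrightarrow> (\<lambda>x. f x * g x) \<in> flat_algebra"

lemma flat_algebra_has_derivative:
  "f \<in> flat_algebra \<Longrightarrow> \<exists>f'\<in>flat_algebra. \<forall>x. (f has_field_derivative f' x) (at x)"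
proof (induction rule: flat_algebra.induct)
  case (const r)
  then show ?case by (intro bexI[of _ "\<lambda>_. 0"] flat_algebra.const) auto
next
  case (flat c p a s)
  let ?q = "monom 1 2 * (smult c p - pderiv p)"
  show ?case
  proof (intro bexI[of _ "\<lambda>x. flat ?q c (a + s * x) * s"] allI)
    fix x
    have "((\<lambda>x. a + s * x) has_field_derivative s) (at x)"
      by (auto intro!: derivative_eq_intros)
    from DERIV_chain2[OF flat_has_derivative[OF flat] this]
    show "((\<lambda>x. flat p c (a + s * x)) has_field_derivative flat ?q c (a + s * x) * s) (at x)" .
  next
    show "(\<lambda>x. flat ?q c (a + s * x) * s) \<in> flat_algebra"
      by (intro flat_algebra.mult flat_algebra.flat flat_algebra.const flat)
  qed
next
  case (add f g)
  then obtain f' g' where "f' \<in> flat_algebra" "g' \<in> flat_algebra"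
    "\<forall>x. (f has_field_derivative f' x) (at x)" "\<forall>x. (g has_field_derivative g' x) (at x)" by blast
  then show ?case
    by (intro bexI[of _ "\<lambda>x. f' x + g' x"] allI DERIV_add flat_algebra.add) auto
next
  case (mult f g)
  then obtain f' g' where *: "f' \<in> flat_algebra" "g' \<in> flat_algebra"
    "\<forall>x. (f has_field_derivative f' x) (at x)" "\<forall>x. (g has_field_derivative g' x) (at x)" by blast
  show ?case
  proof (intro bexI[of _ "\<lambda>x. f' x * g x + g' x * f x"] allI)
    show "((\<lambda>x. f x * g x) has_field_derivative f' x * g x + g' x * f x) (at x)" for x
      using * by (intro DERIV_mult) auto
    show "(\<lambda>x. f' x * g x + g' x * f x) \<in> flat_algebra"
      using * mult by (intro flat_algebra.add flat_algebra.mult)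
  qed
qed

lemma flat_algebra_deriv: "f \<in> flat_algebra \<Longrightarrow> deriv f \<in> flat_algebra"
proof -
  assume "f \<in> flat_algebra"
  from flat_algebra_has_derivative[OF this] obtain f' where
    f': "f' \<in> flat_algebra" "\<And>x. (f has_field_derivative f' x) (at x)" by blast
  then have "deriv f = f'" by (intro ext DERIV_imp_deriv)
  with f' show ?thesis by simp
qed

lemma flat_algebra_smooth:
  assumes "f \<in> flat_algebra"
  shows "(deriv ^^ n) f field_differentiable at y"
proof -
  have "(deriv ^^ n) f \<in> flat_algebra"
    by (induction n) (simp_all add: assms flat_algebra_deriv)
  from flat_algebra_has_derivative[OF this] show ?thesis
    unfolding field_differentiable_def by blast
qed

lemma flat_algebra_continuous: "f \<in> flat_algebra \<Longrightarrow> continuous_on S f"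
  using flat_algebra_smooth[of f 0]
  by (auto intro!: continuous_at_imp_continuous_on field_differentiable_imp_continuous_at)

section \<open>Test functions, their supports and primitives\<close>

lemma test_functionI:
  assumes "\<And>n y. (deriv ^^ n) f field_differentiable at y"
    and "-1 < a" "b < 1" "\<And>y. y \<notin> {a..b} \<Longrightarrow> f y = 0"
  shows "test_function f"
proof -
  have sub: "closure {y. f y \<noteq> 0} \<subseteq> {a..b}"
    by (rule closure_minimal) (use assms(4) in blast, simp)
  then have "bounded (closure {y. f y \<noteq> 0})"
    by (rule bounded_subset[rotated]) simp
  moreover have "{a..b} \<subseteq> \<I>" using assms by auto
  ultimately show ?thesis
    unfolding test_function_def using sub assms(1) by (auto simp: compact_eq_bounded_closed)
qed

lemma test_function_support:
  assumes "test_function f"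
  obtains a b where "-1 < a" "a < b" "b < 1" "\<And>y. y \<notin> {a..b} \<Longrightarrow> f y = 0"
    "\<And>y. y \<notin> {a..b} \<Longrightarrow> deriv f y = 0"
proof -
  \<comment> \<open>The point 0 keeps the set nonempty when \<open>f\<close> vanishes
    identically.\<close>
  define K where "K = insert 0 (closure {y. f y \<noteq> 0})"
  have K: "compact K" "K \<subseteq> \<I>" "K \<noteq> {}"
    using assms unfolding K_def test_function_def by auto
  obtain m where m: "m \<in> K" "\<And>x. x \<in> K \<Longrightarrow> m \<le> x" using compact_attains_inf[OF K(1,3)] by blast
  obtain M where M: "M \<in> K" "\<And>x. x \<in> K \<Longrightarrow> x \<le> M" using compact_attains_sup[OF K(1,3)] by blast
  \<comment> \<open>Midpoints between the extreme points of \<open>K\<close> and the ends of the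
    interval; the margin ensures \<open>a < b\<close> even if \<open>K\<close> is a single
    point.\<close>
  define a b where "a = (m - 1) / 2" and "b = (M + 1) / 2"
  have mM: "m \<le> M" "-1 < m" "M < 1" using m M K by auto
  have zero: "f y = 0" if "y \<notin> {a..b}" for y
  proof (rule ccontr)
    assume "f y \<noteq> 0"
    then have "y \<in> K" unfolding K_def using closure_subset[of "{y. f y \<noteq> 0}"] by auto
    then show False using m(2)[of y] M(2)[of y] that mM unfolding a_def b_def by simp
  qed
  have "deriv f y = 0" if "y \<notin> {a..b}" for y
  proof -
    have "open (- {a..b})" by auto
    then have "\<forall>\<^sub>F z in nhds y. z \<in> - {a..b}" using that by (intro eventually_nhds_in_open) auto
    then have "\<forall>\<^sub>F z in nhds y. f z = 0" by eventually_elim (use zero in auto)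
    then have "(f has_field_derivative 0) (at y)"
      by (subst DERIV_cong_ev[OF refl _ refl, of f "\<lambda>_. 0"]) auto
    then show ?thesis by (rule DERIV_imp_deriv)
  qed
  moreover have "-1 < a" "a < b" "b < 1" using mM by (simp_all add: a_def b_def)
  ultimately show thesis using that zero by metis
qed

text \<open>On the interval this is exp(-(1/(x-a) + 1/(b-x))/(n+1)). The small constant in the
  exponent lets the bumps increase to the indicator of the open interval as \<open>n\<close> grows,
  so they can replace it under dominated convergence.\<close>

definition bump :: "nat \<Rightarrow> real \<Rightarrow> real \<Rightarrow> real \<Rightarrow> real" where
  "bump n a b x = flat 1 (1 / Suc n) (x - a) * flat 1 (1 / Suc n) (b - x)"

lemma bump_flat_algebra: "bump n a b \<in> flat_algebra"
proof -
  have "bump n a b = (\<lambda>x. flat 1 (1 / Suc n) (- a + 1 * x) * flat 1 (1 / Suc n) (b + (-1) * x))"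
    by (auto simp: bump_def fun_eq_iff)
  also have "\<dots> \<in> flat_algebra"
    by (intro flat_algebra.mult flat_algebra.flat) auto
  finally show ?thesis .
qed

lemma bump_eq_0: "x \<notin> {a<..<b} \<Longrightarrow> bump n a b x = 0"
  by (auto simp: bump_def flat_def)

lemma bump_pos: "x \<in> {a<..<b} \<Longrightarrow> bump n a b x > 0"
  by (auto simp: bump_def flat_def)

lemma bump_nonneg: "bump n a b x \<ge> 0"
  by (auto simp: bump_def flat_def)

lemma bump_le_1: "bump n a b x \<le> 1"
  unfolding bump_def flat_def by (auto intro!: mult_le_one)

lemma bump_tendsto: "(\<lambda>n. bump n a b x) \<longlonglongrightarrow> indicator {a<..<b} x"
proof (cases "x \<in> {a<..<b}")
  case True
  have "(\<lambda>n. exp (- ((1 / real (Suc n)) / (x - a))) * exp (- ((1 / real (Suc n)) / (b - x)))) \<longlonglongrightarrow> exp (- (0 / (x - a))) * exp (- (0 / (b - x)))"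
    using True by (intro tendsto_intros LIMSEQ_Suc lim_1_over_n) auto
  then show ?thesis using True by (simp add: bump_def flat_def)
next
  case False
  then show ?thesis by (simp add: bump_eq_0)
qed

text \<open>The primitive vanishing at -1 is constant on either side of the support of
  \<open>h\<close>; it is 0 on the left by normalisation and on the right because \<open>h\<close>
  has mean zero. It may leave the algebra, but its derivatives are those of \<open>h\<close>, which
  is enough for smoothness.\<close>

lemma flat_algebra_antiderivative:
  assumes "h \<in> flat_algebra" "-1 < p" "p < q" "q < 1" "\<And>y. y \<notin> {p..q} \<Longrightarrow> h y = 0"
    and int0: "integral {-1..1} h = 0"
  obtains \<theta> where "test_function \<theta>" "deriv \<theta> = h"
proof -
  have "\<exists>F. \<forall>x :: real. - \<infinity> < ereal x \<longrightarrow> ereal x < \<infinity> \<longrightarrow> (F has_vector_derivative h x) (at x)"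
    by (rule einterval_antiderivative)
       (use flat_algebra_continuous[OF assms(1), of UNIV] in \<open>auto simp: continuous_on_eq_continuous_at\<close>)
  then obtain F where "\<And>x. (F has_vector_derivative h x) (at x)" by auto
  then have F: "(F has_field_derivative h x) (at x)" for x
    by (simp add: has_real_derivative_iff_has_vector_derivative)
  define \<theta> where "\<theta> x = F x - F (-1)" for x
  have D: "(\<theta> has_field_derivative h x) (at x)" for x
    unfolding \<theta>_def by (auto intro!: derivative_eq_intros F)
  then have deriv: "deriv \<theta> = h" by (intro ext DERIV_imp_deriv)
  have "(h has_integral (\<theta> 1 - \<theta> (-1))) {-1..1}"
    by (rule fundamental_theorem_of_calculus)
       (auto simp: has_real_derivative_iff_has_vector_derivative[symmetric] intro: has_field_derivative_at_within D)
  then have ends: "\<theta> 1 = 0" "\<theta> (-1) = 0"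
    using int0 by (auto simp: \<theta>_def dest!: integral_unique)
  have const: "\<theta> y = \<theta> z" if "convex S" "S \<inter> {p..q} = {}" "y \<in> S" "z \<in> S" for S y z
  proof -
    have "\<exists>c. \<forall>x\<in>S. \<theta> x = c"
    proof (rule has_field_derivative_zero_constant[OF that(1)])
      fix x assume "x \<in> S"
      then have "h x = 0" using that(2) assms(5) by blast
      then show "(\<theta> has_field_derivative 0) (at x within S)"
        using has_field_derivative_at_within[OF D, of x S] by simp
    qed
    then show ?thesis using that by metis
  qed
  have zero: "\<theta> y = 0" if "y \<notin> {p..q}" for y
  proof (cases "y < p")
    case True
    moreover have "{..<p} \<inter> {p..q} = {}" by auto
    ultimately show ?thesis using const[of "{..<p}" y "-1"] assms(2) ends by simp
  next
    case False
    moreover have "{q<..} \<inter> {p..q} = {}" by auto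
    ultimately show ?thesis using that const[of "{q<..}" y 1] assms(4) ends by simp
  qed
  have "(deriv ^^ n) \<theta> field_differentiable at y" for n y
  proof (cases n)
    case 0
    then show ?thesis using D by (auto simp: field_differentiable_def)
  next
    case (Suc m)
    have "(deriv ^^ n) \<theta> = (deriv ^^ m) h" by (simp only: Suc funpow_Suc_right o_apply deriv)
    then show ?thesis using flat_algebra_smooth[OF assms(1)] by simp
  qed
  then have "test_function \<theta>"
    by (rule test_functionI) (use assms zero in auto)
  then show thesis using that deriv by blast
qed

lemma test_function_bump:
  assumes "-1 < a" "b < 1"
  shows "test_function (bump n a b)"
  by (rule test_functionI[OF flat_algebra_smooth[OF bump_flat_algebra] assms]) (rule bump_eq_0, auto)

subsection \<open>Weak derivatives\<close>

lemma locally_integrable_imp_integrable_lebesgue: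
  assumes "locally_integrable g" "K \<subseteq> {a..b}" "-1 < a" "b < 1" "K \<in> sets borel"
  shows "integrable lebesgue (\<lambda>x. indicator K x *\<^sub>R g x)"
proof -
  have "integrable (lebesgue_on {a..b}) g"
  proof -
    have "{a..b} \<subseteq> \<I>" using assms(3,4) by auto
    moreover have "compact {a..b}" by simp
    ultimately show ?thesis using assms(1) unfolding locally_integrable_def by blast
  qed
  then have "integrable lebesgue (\<lambda>x. indicator {a..b} x *\<^sub>R g x)"
    by (subst (asm) integrable_restrict_space) auto
  then have "integrable lebesgue (\<lambda>x. indicator K x *\<^sub>R (indicator {a..b} x *\<^sub>R g x))"
    by (rule integrable_mult_indicator[rotated]) (use assms in auto)
  also have "(\<lambda>x. indicator K x *\<^sub>R (indicator {a..b} x *\<^sub>R g x)) = (\<lambda>x. indicator K x *\<^sub>R g x)"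
    using assms(2) by (auto simp: indicator_def fun_eq_iff)
  finally show ?thesis .
qed

lemma locally_integrable_diff:
  "locally_integrable f \<Longrightarrow> locally_integrable g \<Longrightarrow> locally_integrable (\<lambda>x. f x - g x)"
  unfolding locally_integrable_def by auto

lemma integrable_leb_I_imp_locally_integrable:
  assumes "integrable leb_I f"
  shows "locally_integrable f"
  unfolding locally_integrable_def
proof (intro allI impI)
  fix K assume K: "compact K \<and> K \<subseteq> \<I>"
  then have sets: "K \<in> sets lebesgue"
    by (auto intro!: sets_completionI_sets borel_compact)
  have "integrable lebesgue (\<lambda>x. indicator K x *\<^sub>R (indicator \<I> x *\<^sub>R f x))"
    by (rule integrable_mult_indicator[OF sets]) (use assms integrable_leb_I_iff in blast)
  also have "(\<lambda>x. indicator K x *\<^sub>R (indicator \<I> x *\<^sub>R f x)) = (\<lambda>x. indicator K x *\<^sub>R f x)"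
    using K by (auto simp: indicator_def fun_eq_iff)
  finally show "integrable (lebesgue_on K) f"
    using sets by (subst integrable_restrict_space) auto
qed

lemma integrable_leb_I_compact_support:
  fixes \<psi> :: "real \<Rightarrow> real"
  assumes "locally_integrable f" "continuous_on UNIV \<psi>" "-1 < a" "b < 1" "\<And>y. y \<notin> {a..b} \<Longrightarrow> \<psi> y = 0"
  shows "integrable leb_I (\<lambda>y. \<psi> y *\<^sub>R f y)"
proof -
  have "integrable leb_I (\<lambda>x. indicator {a..b} x *\<^sub>R f x)"
  proof -
    have "integrable lebesgue (\<lambda>x. indicator {a..b} x *\<^sub>R f x)"
      by (rule locally_integrable_imp_integrable_lebesgue[OF assms(1) order_refl assms(3,4)]) simp
    also have "(\<lambda>x. indicator {a..b} x *\<^sub>R f x) = (\<lambda>x. indicator \<I> x *\<^sub>R (indicator {a..b} x *\<^sub>R f x))"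
      using assms(3,4) by (auto simp: indicator_def fun_eq_iff)
    finally show ?thesis unfolding integrable_leb_I_iff .
  qed
  then have "integrable leb_I (\<lambda>x. complex_of_real (\<psi> x) * (indicator {a..b} x *\<^sub>R f x))"
    using assms(2)
    by (intro bounded_times_integrable_leb_I continuous_intros) (auto intro: continuous_on_subset)
  also have "(\<lambda>x. complex_of_real (\<psi> x) * (indicator {a..b} x *\<^sub>R f x)) = (\<lambda>y. \<psi> y *\<^sub>R f y)"
    using assms(5) by (auto simp: indicator_def fun_eq_iff scaleR_conv_of_real)
  finally show ?thesis .
qed

lemma test_function_deriv:
  assumes "test_function \<theta>"
  shows "(\<theta> has_field_derivative deriv \<theta> y) (at y)"
    "continuous_on S \<theta>" "continuous_on S (deriv \<theta>)"
proof -
  have *: "(deriv ^^ n) \<theta> field_differentiable at y" for n y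
    using assms by (simp add: test_function_def)
  show "(\<theta> has_field_derivative deriv \<theta> y) (at y)"
    using *[of 0 y] by (simp add: field_differentiable_derivI)
  show "continuous_on S \<theta>" "continuous_on S (deriv \<theta>)"
    using *[of 0] *[of 1]
    by (auto intro!: continuous_at_imp_continuous_on field_differentiable_imp_continuous_at)
qed

lemma test_function_integrable:
  assumes "test_function \<theta>" "locally_integrable f"
  shows "integrable leb_I (\<lambda>y. \<theta> y *\<^sub>R f y)" "integrable leb_I (\<lambda>y. deriv \<theta> y *\<^sub>R f y)"
proof -
  obtain a b where ab: "-1 < a" "a < b" "b < 1" "\<And>y. y \<notin> {a..b} \<Longrightarrow> \<theta> y = 0"
    "\<And>y. y \<notin> {a..b} \<Longrightarrow> deriv \<theta> y = 0"
    using test_function_support[OF assms(1)] by metis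
  show "integrable leb_I (\<lambda>y. \<theta> y *\<^sub>R f y)" "integrable leb_I (\<lambda>y. deriv \<theta> y *\<^sub>R f y)"
    using assms(2) ab test_function_deriv[OF assms(1)]
    by (blast intro: integrable_leb_I_compact_support)+
qed

section \<open>Functions orthogonal to every bump\<close>

text \<open>Bumps take values in [0,1] and converge to the indicator, so \<open>norm (G y)\<close>
  dominates.\<close>

lemma bump_orthogonal_imp_interval_integral_0:
  assumes "locally_integrable g" "-1 < a" "a < b" "b < 1"
    and "\<And>n. (LINT y|leb_I. bump n a b y *\<^sub>R g y) = 0"
  shows "(LINT y|lebesgue. indicator {a<..<b} y *\<^sub>R g y) = 0"
proof -
  define G where "G = (\<lambda>y. indicator {a<..<b} y *\<^sub>R g y)"
  have G: "integrable lebesgue G"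
    unfolding G_def by (rule locally_integrable_imp_integrable_lebesgue[of _ _ a b]) (use assms in auto)
  have "(\<lambda>n. LINT y|lebesgue. bump n a b y *\<^sub>R G y) \<longlonglongrightarrow> (LINT y|lebesgue. G y)"
  proof (rule integral_dominated_convergence[of _ _ _ "\<lambda>y. norm (G y)"])
    show "AE y in lebesgue. (\<lambda>n. bump n a b y *\<^sub>R G y) \<longlonglongrightarrow> G y"
    proof (rule AE_I2)
      fix y
      have "(\<lambda>n. bump n a b y *\<^sub>R G y) \<longlonglongrightarrow> indicator {a<..<b} y *\<^sub>R G y"
        by (intro tendsto_intros bump_tendsto)
      then show "(\<lambda>n. bump n a b y *\<^sub>R G y) \<longlonglongrightarrow> G y"
        by (cases "y \<in> {a<..<b}") (simp_all add: G_def)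
    qed
    show "AE y in lebesgue. norm (bump n a b y *\<^sub>R G y) \<le> norm (G y)" for n
      using bump_nonneg bump_le_1 by (intro AE_I2) (simp add: mult_left_le_one_le)
    have "bump n a b \<in> borel_measurable lebesgue" for n
      by (intro measurable_completion)
         (simp add: borel_measurable_continuous_onI flat_algebra_continuous bump_flat_algebra)
    then show "(\<lambda>y. bump n a b y *\<^sub>R G y) \<in> borel_measurable lebesgue" for n
      using borel_measurable_integrable[OF G] by (rule borel_measurable_scaleR)
  qed (use G in auto)
  moreover have "(LINT y|lebesgue. bump n a b y *\<^sub>R G y) = 0" for n
  proof -
    have "(LINT y|lebesgue. bump n a b y *\<^sub>R G y) = (LINT y|leb_I. bump n a b y *\<^sub>R g y)"
      unfolding integral_leb_I using assms
      by (intro Bochner_Integration.integral_cong) (auto simp: G_def indicator_def intro: bump_eq_0)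
    then show ?thesis using assms by simp
  qed
  ultimately show ?thesis by (simp add: LIMSEQ_const_iff G_def)
qed

text \<open>Sigma-finiteness passes to the completion. It makes available the criterion that a
  function whose integral over each measurable set vanishes is zero almost everywhere.\<close>

interpretation lebesgue: sigma_finite_measure "lebesgue :: real measure"
proof
  have "\<exists>A. countable A \<and> A \<subseteq> sets lborel \<and> \<Union>A = space (lborel :: real measure) \<and> (\<forall>a\<in>A. emeasure lborel a \<noteq> \<infinity>)"
    by (rule lborel.sigma_finite_countable)
  then obtain A :: "real set set" where A: "countable A" "A \<subseteq> sets lborel" "\<Union>A = space lborel" "\<forall>a\<in>A. emeasure lborel a \<noteq> \<infinity>"
    by (elim exE conjE)
  have "A \<subseteq> sets lebesgue" using A(2) by (blast intro: sets_completionI_sets)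
  moreover have "\<forall>a\<in>A. emeasure lebesgue a \<noteq> \<infinity>"
  proof
    fix a assume "a \<in> A"
    then have "emeasure lborel a \<noteq> \<infinity>" "a \<in> sets lborel" using A(2,4) by blast+
    then show "emeasure lebesgue a \<noteq> \<infinity>" by simp
  qed
  ultimately show "\<exists>A. countable A \<and> A \<subseteq> sets lebesgue \<and> \<Union>A = space (lebesgue :: real measure) \<and> (\<forall>a\<in>A. emeasure lebesgue a \<noteq> \<infinity>)"
    using A(1,3) by (intro exI[of _ A]) simp
qed

text \<open>A Dynkin argument: open intervals form an intersection-stable generator of the Borel
  sets, and the sets with vanishing integral are closed under complements and disjoint countable
  unions.\<close>

lemma interval_integrals_0_imp_AE_0:
  fixes G :: "real \<Rightarrow> 'a :: {second_countable_topology, banach}"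
  assumes G: "integrable lebesgue G" and G0: "(LINT y|lebesgue. G y) = 0"
    and int0: "\<And>a b. (LINT y|lebesgue. indicator {a<..<b} y *\<^sub>R G y) = 0"
  shows "AE y in lebesgue. G y = 0"
proof (rule lebesgue.density_zero[OF G])
  have int: "integrable lebesgue (\<lambda>y. indicator A y *\<^sub>R G y)" if "A \<in> sets lebesgue" for A
    using that by (rule integrable_mult_indicator[OF _ G])
  have borel: "(LINT y|lebesgue. indicator A y *\<^sub>R G y) = 0" if "A \<in> sets borel" for A
  proof -
    let ?B = "range (\<lambda>(a, b). {a <..< b :: real})"
    have stable: "Int_stable ?B"
    proof (rule Int_stableI)
      fix X Y assume "X \<in> ?B" "Y \<in> ?B"
      then obtain a b c d where "X = {a<..<b}" "Y = {c<..<d}" by auto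
      then have "X \<inter> Y = (\<lambda>(a, b). {a <..< b :: real}) (max a c, min b d)" by auto
      then show "X \<inter> Y \<in> ?B" by blast
    qed
    have sb: "sets borel = sigma_sets UNIV ?B"
      by (simp add: borel_eq_box)
    have "?B \<subseteq> Pow UNIV" by simp
    from stable this that[unfolded sb] show ?thesis
    proof (induction rule: sigma_sets_induct_disjoint)
      case (basic A)
      then show ?case using int0 by auto
    next
      case empty
      then show ?case by simp
    next
      case (compl A)
      then have A: "A \<in> sets lebesgue" by (simp flip: sb)
      \<comment> \<open>Complements are where the vanishing of the total integral enters.\<close>
      have "(LINT y|lebesgue. indicator (UNIV - A) y *\<^sub>R G y) = (LINT y|lebesgue. G y - indicator A y *\<^sub>R G y)"
        by (rule Bochner_Integration.integral_cong) (auto simp: indicator_def)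
      then show ?case using compl G0 int[OF A] G by simp
    next
      case (union A)
      then have A: "A i \<in> sets lebesgue" for i using sb by (metis sets_completionI_sets rangeI subsetD sets_lborel)
      have "(LINT y:(\<Union>i. A i)|lebesgue. G y) = (\<Sum>i. (LINT y:(A i)|lebesgue. G y))"
      proof (rule lebesgue_integral_countable_add)
        show "i \<noteq> j \<Longrightarrow> A i \<inter> A j = {}" for i j
          using union by (auto simp: disjoint_family_on_def)
        show "set_integrable lebesgue (\<Union>i. A i) G"
          unfolding set_integrable_def using A by (intro int) auto
      qed (rule A)
      then show ?case using union by (simp add: set_lebesgue_integral_def)
    qed
  qed
  fix A :: "real set" assume "A \<in> sets lebesgue"
  \<comment> \<open>A Lebesgue set is a Borel set up to a negligible set, which no integral
    sees.\<close>
  then obtain B N where BN: "B \<in> sets borel" "negligible N" "B \<union> N = A"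
    using sets_lebesgue_almost_borel by metis
  have "(LINT y|lebesgue. indicator A y *\<^sub>R G y) = (LINT y|lebesgue. indicator B y *\<^sub>R G y)"
  proof (rule Bochner_Integration.integral_cong_AE)
    show "(\<lambda>y. indicat_real A y *\<^sub>R G y) \<in> borel_measurable lebesgue"
      "(\<lambda>y. indicat_real B y *\<^sub>R G y) \<in> borel_measurable lebesgue"
      using int[of A] int[of B] \<open>A \<in> sets lebesgue\<close> BN(1)
      by (auto intro!: borel_measurable_integrable)
    have "AE y in lebesgue. y \<notin> N"
      using BN(2) unfolding negligible_iff_null_sets by (rule AE_not_in)
    then show "AE y in lebesgue. indicat_real A y *\<^sub>R G y = indicat_real B y *\<^sub>R G y"
      by eventually_elim (use BN in \<open>auto simp: indicator_def\<close>)
  qed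
  then show "set_lebesgue_integral lebesgue A G = 0"
    using borel[OF BN(1)] by (simp add: set_lebesgue_integral_def)
qed

text \<open>Local integrability says nothing up to the endpoints, so the argument runs on intervals
  whose closure lies inside, and countably many of these exhaust the whole.\<close>

lemma bump_orthogonal_imp_AE_0:
  assumes g: "locally_integrable g"
    and orth: "\<And>n a b. -1 < a \<Longrightarrow> a < b \<Longrightarrow> b < 1 \<Longrightarrow> (LINT y|leb_I. bump n a b y *\<^sub>R g y) = 0"
  shows "AE y in leb_I. g y = 0"
proof -
  have loc: "AE y in lebesgue. indicator {p<..<q} y *\<^sub>R g y = 0" if pq: "-1 < p" "p < q" "q < 1" for p q
  proof (rule interval_integrals_0_imp_AE_0)
    show "integrable lebesgue (\<lambda>y. indicator {p<..<q} y *\<^sub>R g y)"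
      by (rule locally_integrable_imp_integrable_lebesgue[of _ _ p q]) (use g pq in auto)
    show "(LINT y|lebesgue. indicator {p<..<q} y *\<^sub>R g y) = 0"
      using pq by (intro bump_orthogonal_imp_interval_integral_0 g orth)
    fix a b :: real
    have eq: "(\<lambda>y. indicator {a<..<b} y *\<^sub>R (indicator {p<..<q} y *\<^sub>R g y)) =
        (\<lambda>y. indicator {max a p<..<min b q} y *\<^sub>R g y)"
      by (auto simp: indicator_def)
    show "(LINT y|lebesgue. indicator {a<..<b} y *\<^sub>R (indicator {p<..<q} y *\<^sub>R g y)) = 0"
    proof (cases "max a p < min b q")
      case True
      then show ?thesis unfolding eq using pq
        by (intro bump_orthogonal_imp_interval_integral_0 g orth) auto
    next
      case False
      then have "{max a p<..<min b q} = {}" by auto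
      then show ?thesis unfolding eq by simp
    qed
  qed
  \<comment> \<open>The summand 2 keeps \<open>r 0\<close> positive, so that every interval from
    \<open>- r n\<close> to \<open>r n\<close> is nonempty.\<close>
  define r where "r n = 1 - 1 / (real n + 2)" for n
  have r: "0 < r n" "r n < 1" for n by (auto simp: r_def field_simps)
  have "AE y in lebesgue. \<forall>n. indicator {- r n<..<r n} y *\<^sub>R g y = 0"
    unfolding AE_all_countable using r by (intro allI loc) (auto intro: less_trans[of _ 0])
  then show ?thesis
    unfolding AE_leb_I_iff
  proof eventually_elim
    case (elim y)
    show ?case
    proof
      assume "y \<in> \<I>"
      then have "0 < 1 - \<bar>y\<bar>" by auto
      then obtain n where n: "1 / real (Suc n) < 1 - \<bar>y\<bar>" by (meson nat_approx_posE)
      have "1 / (real n + 2) < 1 / real (Suc n)" by (simp add: field_simps)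
      then have "y \<in> {- r n<..<r n}" using n by (auto simp: r_def)
      then show "g y = 0" using elim[rule_format, of n] by simp
    qed
  qed
qed

section \<open>Uniqueness of weak derivatives and their primitives\<close>

text \<open>The theorem speaks of given weak derivatives, while membership in
  \<open>H\<^sup>2\<close> supplies square-integrable ones of its own; this identifies the
  two.\<close>

lemma weak_deriv_unique:
  assumes "weak_deriv f1 g1" "weak_deriv f2 g2" "AE y in leb_I. f1 y = f2 y"
  shows "AE y in leb_I. g1 y = g2 y"
proof -
  have loc: "locally_integrable f1" "locally_integrable g1" "locally_integrable f2" "locally_integrable g2"
    using assms by (auto simp: weak_deriv_def)
  have "AE y in leb_I. g1 y - g2 y = 0"
  proof (rule bump_orthogonal_imp_AE_0)
    show "locally_integrable (\<lambda>y. g1 y - g2 y)" using loc by (intro locally_integrable_diff)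
    fix n and a b :: real assume "-1 < a" "a < b" "b < 1"
    then have \<theta>: "test_function (bump n a b)" by (intro test_function_bump)
    have "(LINT y|leb_I. deriv (bump n a b) y *\<^sub>R f1 y) = (LINT y|leb_I. deriv (bump n a b) y *\<^sub>R f2 y)"
      using assms(3)
      by (intro Bochner_Integration.integral_cong_AE borel_measurable_integrable test_function_integrable \<theta> loc)
         (auto elim: eventually_mono)
    then have "(LINT y|leb_I. bump n a b y *\<^sub>R g1 y) = (LINT y|leb_I. bump n a b y *\<^sub>R g2 y)"
      using assms(1,2) \<theta> by (simp add: weak_deriv_def)
    moreover have "integrable leb_I (\<lambda>y. bump n a b y *\<^sub>R g1 y)" "integrable leb_I (\<lambda>y. bump n a b y *\<^sub>R g2 y)"
      by (rule test_function_integrable[OF \<theta>], fact)+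
    ultimately show "(LINT y|leb_I. bump n a b y *\<^sub>R (g1 y - g2 y)) = 0"
      by (simp add: scaleR_diff_right)
  qed
  then show ?thesis by simp
qed

text \<open>A bump \<open>\<psi>\<close> minus the multiple of a fixed bump with the same integral has a test function as
  primitive, so \<open>h\<close> minus a suitable constant is orthogonal to every bump.\<close>

lemma weak_deriv_0_imp_const:
  assumes h: "locally_integrable h"
    and orth: "\<And>\<theta>. test_function \<theta> \<Longrightarrow> (LINT y|leb_I. deriv \<theta> y *\<^sub>R h y) = 0"
  shows "\<exists>c. AE y in leb_I. h y = c"
proof -
  define \<psi>0 where "\<psi>0 = bump 0 (-1/2) (1/2)"
  have contI: "continuous_on S (bump n a b)" for S n a b
    by (simp add: flat_algebra_continuous bump_flat_algebra)
  define s where "s = integral {-1..1} \<psi>0"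
  have "s > 0"
  proof -
    have "0 \<le> s" unfolding s_def \<psi>0_def by (intro integral_nonneg integrable_continuous_real contI bump_nonneg)
    moreover have "s \<noteq> 0"
    proof
      assume "s = 0"
      then have "\<forall>x\<in>{-1..1}. \<psi>0 x = 0"
        unfolding s_def \<psi>0_def by (subst (asm) integral_eq_0_iff) (auto intro: contI simp: bump_nonneg)
      then show False using bump_pos[of 0 "-1/2" "1/2" 0] by (auto simp: \<psi>0_def)
    qed
    ultimately show ?thesis by simp
  qed
  have \<psi>0: "test_function \<psi>0" unfolding \<psi>0_def by (rule test_function_bump) auto
  \<comment> \<open>A weighted mean of \<open>h\<close>: if \<open>h\<close> is almost everywhere
    constant, this is its value.\<close>
  define c where "c = (1 / s) *\<^sub>R (LINT y|leb_I. \<psi>0 y *\<^sub>R h y)"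
  have cint: "locally_integrable (\<lambda>y. c)"
    by (rule integrable_leb_I_imp_locally_integrable) simp
  have "AE y in leb_I. h y - c = 0"
  proof (rule bump_orthogonal_imp_AE_0)
    show "locally_integrable (\<lambda>y. h y - c)" using h cint by (rule locally_integrable_diff)
    fix n and a b :: real assume ab: "-1 < a" "a < b" "b < 1"
    define \<psi> where "\<psi> = bump n a b"
    have \<psi>: "test_function \<psi>" unfolding \<psi>_def using ab by (intro test_function_bump)
    define r where "r = integral {-1..1} \<psi> / s"
    define d where "d y = \<psi> y - r * \<psi>0 y" for y
    have d_alg: "d \<in> flat_algebra"
    proof -
      have "d = (\<lambda>y. bump n a b y + (- r) * bump 0 (-1/2) (1/2) y)"
        by (auto simp: d_def \<psi>_def \<psi>0_def)
      also have "\<dots> \<in> flat_algebra"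
        by (intro flat_algebra.add flat_algebra.mult flat_algebra.const bump_flat_algebra)
      finally show ?thesis .
    qed
    have int: "\<psi> integrable_on {-1..1}" "\<psi>0 integrable_on {-1..1}"
      unfolding \<psi>_def \<psi>0_def by (intro integrable_continuous_real contI)+
    have "integral {-1..1} d = integral {-1..1} \<psi> - r * s"
      unfolding d_def s_def using int
      by (subst Henstock_Kurzweil_Integration.integral_diff) (auto intro: integrable_on_mult_right)
    then have d0: "integral {-1..1} d = 0" using \<open>s > 0\<close> by (simp add: r_def)
    obtain \<theta> where \<theta>: "test_function \<theta>" "deriv \<theta> = d"
    proof (rule flat_algebra_antiderivative[OF d_alg _ _ _ _ d0])
      show "-1 < min a (-1/2)" "min a (-1/2) < max b (1/2)" "max b (1/2) < 1" using ab by auto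
      show "d y = 0" if "y \<notin> {min a (-1/2)..max b (1/2)}" for y
      proof -
        have "y \<notin> {a<..<b}" "y \<notin> {-1/2<..<1/2}" using that by auto
        then show ?thesis by (simp add: d_def \<psi>_def \<psi>0_def bump_eq_0)
      qed
    qed
    have ih: "integrable leb_I (\<lambda>y. \<psi> y *\<^sub>R h y)" "integrable leb_I (\<lambda>y. \<psi>0 y *\<^sub>R h y)" "integrable leb_I (\<lambda>y. \<psi> y *\<^sub>R c)"
      by (rule test_function_integrable[OF \<psi> h] test_function_integrable[OF \<psi>0 h] test_function_integrable[OF \<psi> cint])+
    have "0 = (LINT y|leb_I. \<psi> y *\<^sub>R h y - r *\<^sub>R (\<psi>0 y *\<^sub>R h y))"
      using orth[OF \<theta>(1)] by (simp add: \<theta> d_def scaleR_diff_left)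
    also have "\<dots> = (LINT y|leb_I. \<psi> y *\<^sub>R h y) - r *\<^sub>R (LINT y|leb_I. \<psi>0 y *\<^sub>R h y)"
      using ih(1,2) by (simp del: scaleR_scaleR)
    also have "r *\<^sub>R (LINT y|leb_I. \<psi>0 y *\<^sub>R h y) = (LINT y|leb_I. \<psi> y *\<^sub>R c)"
    proof -
      have "integrable leb_I \<psi>"
        unfolding \<psi>_def by (intro integrable_leb_I_continuous contI)
      then have "(LINT y|leb_I. \<psi> y) = integral {-1..1} \<psi>"
        by (subst lebesgue_integral_eq_integral) (simp_all add: integral_open_interval_real)
      then show ?thesis using \<open>integrable leb_I \<psi>\<close> \<open>s > 0\<close> by (simp add: c_def r_def)
    qed
    finally show "(LINT y|leb_I. bump n a b y *\<^sub>R (h y - c)) = 0"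
      using ih by (simp add: scaleR_diff_right flip: \<psi>_def)
  qed
  then show ?thesis by (intro exI[of _ c]) simp
qed

text \<open>By the product rule with a test function, the indefinite integral \<open>G\<close> of
  \<open>g\<close> has weak derivative \<open>g\<close>. Hence \<open>f - G\<close> has weak
  derivative 0 and is a constant, which can be added to \<open>G\<close> because \<open>AC\<close>
  sees only increments.\<close>

lemma weak_deriv_imp_AC:
  assumes fg: "weak_deriv f g" and g: "integrable leb_I g"
  obtains F where "AC F g" "AE y in leb_I. f y = F y"
proof -
  define G where "G y = (LINT t|leb_I. indicator {..y} t *\<^sub>R g t)" for y
  have G: "AC G g" unfolding G_def using g by (rule AC_indefinite_integral)
  have locf: "locally_integrable f" and locg: "locally_integrable g" using fg by (auto simp: weak_deriv_def)
  have locG: "locally_integrable G"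
    by (intro integrable_leb_I_imp_locally_integrable integrable_leb_I_continuous AC_continuous_on[OF G])
  obtain c where c: "AE y in leb_I. f y - G y = c"
  proof -
    have "\<exists>c. AE y in leb_I. f y - G y = c"
    proof (rule weak_deriv_0_imp_const)
      show "locally_integrable (\<lambda>y. f y - G y)" using locf locG by (rule locally_integrable_diff)
      fix \<theta> assume \<theta>: "test_function \<theta>"
      note i = test_function_integrable[OF \<theta>]
      have "AC (\<lambda>y. complex_of_real (\<theta> y)) (\<lambda>y. complex_of_real (deriv \<theta> y))"
        by (intro AC_C1 continuous_intros test_function_deriv[OF \<theta>] has_vector_derivative_of_real
              has_vector_derivative_at_within has_real_derivative_iff_has_vector_derivative[THEN iffD1])
      from AC_diff_eq[OF AC_mult[OF this G]]
      have "(LINT y|leb_I. deriv \<theta> y *\<^sub>R G y + \<theta> y *\<^sub>R g y) = \<theta> 1 * G 1 - \<theta> (-1) * G (-1)"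
        by (simp add: scaleR_conv_of_real)
      moreover have "\<theta> 1 = 0" "\<theta> (-1) = 0"
        using test_function_support[OF \<theta>] by (metis atLeastAtMost_iff not_le)+
      ultimately have "(LINT y|leb_I. deriv \<theta> y *\<^sub>R G y) + (LINT y|leb_I. \<theta> y *\<^sub>R g y) = 0"
        using i locG locg by simp
      moreover have "(LINT y|leb_I. deriv \<theta> y *\<^sub>R f y) + (LINT y|leb_I. \<theta> y *\<^sub>R g y) = 0"
        using fg \<theta> by (simp add: weak_deriv_def)
      ultimately show "(LINT y|leb_I. deriv \<theta> y *\<^sub>R (f y - G y)) = 0"
        using i locf locG by (simp add: scaleR_diff_right) (metis add_right_cancel)
    qed
    then show thesis using that by blast
  qed
  show thesis
  proof
    show "AC (\<lambda>y. G y + c) g" using G by (simp add: AC_def)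
    show "AE y in leb_I. f y = G y + c" using c by eventually_elim (auto simp: algebra_simps)
  qed
qed

subsection \<open>Square-integrable functions and \<open>H\<^sup>2\<close> representatives\<close>

text \<open>Completeness of Lebesgue measure. It lets norms of given functions be computed from
  their representatives.\<close>

lemma borel_measurable_leb_I_AE:
  fixes f g :: "real \<Rightarrow> 'a :: euclidean_space"
  assumes "f \<in> borel_measurable leb_I" "AE y in leb_I. f y = g y"
  shows "g \<in> borel_measurable leb_I"
proof -
  have sets: "\<I> \<inter> space lebesgue \<in> sets lebesgue" by simp
  have "(\<lambda>y. indicator \<I> y *\<^sub>R f y) \<in> borel_measurable lebesgue"
    using assms(1) by (subst (asm) borel_measurable_restrict_space_iff[OF sets])
  moreover have "AE y in lebesgue. indicator \<I> y *\<^sub>R f y = indicator \<I> y *\<^sub>R g y"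
    using assms(2) unfolding AE_leb_I_iff by eventually_elim (auto simp: indicator_def)
  ultimately have "(\<lambda>y. indicator \<I> y *\<^sub>R g y) \<in> borel_measurable lebesgue"
    by (rule borel_measurable_AE)
  then show ?thesis by (subst borel_measurable_restrict_space_iff[OF sets])
qed

lemma integral_leb_I_cong_AE:
  fixes f g :: "real \<Rightarrow> 'a :: euclidean_space"
  assumes "f \<in> borel_measurable leb_I" "AE y in leb_I. f y = g y"
  shows "(LINT y|leb_I. g y) = (LINT y|leb_I. f y)"
  using borel_measurable_leb_I_AE[OF assms] assms
  by (intro Bochner_Integration.integral_cong_AE) (auto elim: eventually_mono)

lemma L2_norm_nonneg: "L2_norm f \<ge> 0"
  by (simp add: L2_norm_def)

lemma L2_norm_power2: "(L2_norm f)\<^sup>2 = (LINT y|leb_I. (norm (f y))\<^sup>2)"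
  by (simp add: L2_norm_def)

lemma L2_norm_cong_AE:
  fixes f g :: "real \<Rightarrow> 'a :: real_normed_vector"
  assumes "f \<in> borel_measurable leb_I" "AE y in leb_I. g y = f y"
  shows "L2_norm g = L2_norm f"
  unfolding L2_norm_def
proof (intro arg_cong[of _ _ sqrt] integral_leb_I_cong_AE)
  show "(\<lambda>y. (norm (f y))\<^sup>2) \<in> borel_measurable leb_I"
    using assms(1) by measurable
  show "AE y in leb_I. (norm (f y))\<^sup>2 = (norm (g y))\<^sup>2"
    using assms(2) by eventually_elim simp
qed

lemma L1_norm_cong_AE:
  fixes f g :: "real \<Rightarrow> 'a :: real_normed_vector"
  assumes "f \<in> borel_measurable leb_I" "AE y in leb_I. g y = f y"
  shows "L1_norm g = L1_norm f"
  unfolding L1_norm_def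
proof (intro integral_leb_I_cong_AE)
  show "(\<lambda>y. norm (f y)) \<in> borel_measurable leb_I"
    using assms(1) by measurable
  show "AE y in leb_I. norm (f y) = norm (g y)"
    using assms(2) by eventually_elim simp
qed

lemma L2_space_continuous:
  assumes "continuous_on {-1..1} f"
  shows "f \<in> L\<^sup>2"
  unfolding L2_space_def
  using assms by (auto intro!: borel_measurable_leb_I_continuous integrable_leb_I_continuous continuous_intros)

lemma L2_space_integrable:
  assumes "f \<in> L\<^sup>2"
  shows "integrable leb_I f"
proof -
  have m: "f \<in> borel_measurable leb_I" and i: "integrable leb_I (\<lambda>y. (norm (f y))\<^sup>2)"
    using assms by (auto simp: L2_space_def)
  have "integrable leb_I (\<lambda>y. norm (f y))"
    by (rule leb_I.square_integrable_imp_integrable[OF _ i]) (use m in measurable)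
  then show ?thesis using m by (simp add: integrable_norm_iff)
qed

text \<open>The discriminant argument: the integral of (t|f| - |g|)^2 is a nonnegative quadratic in
  t.\<close>

lemma Cauchy_Schwarz_L2:
  assumes "f \<in> L\<^sup>2" "g \<in> L\<^sup>2"
  shows "integrable leb_I (\<lambda>y. f y * g y)"
    and "(LINT y|leb_I. norm (f y * g y)) \<le> L2_norm f * L2_norm g"
    and "norm (LINT y|leb_I. f y * g y) \<le> L2_norm f * L2_norm g"
proof -
  have m: "f \<in> borel_measurable leb_I" "g \<in> borel_measurable leb_I"
    and i: "integrable leb_I (\<lambda>y. (norm (f y))\<^sup>2)" "integrable leb_I (\<lambda>y. (norm (g y))\<^sup>2)"
    using assms by (auto simp: L2_space_def)
  show ifg: "integrable leb_I (\<lambda>y. f y * g y)"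
  proof (rule Bochner_Integration.integrable_bound)
    show "integrable leb_I (\<lambda>y. (norm (f y))\<^sup>2 + (norm (g y))\<^sup>2)" using i by simp
    show "(\<lambda>y. f y * g y) \<in> borel_measurable leb_I" using m by (rule borel_measurable_times)
    show "AE y in leb_I. norm (f y * g y) \<le> norm ((norm (f y))\<^sup>2 + (norm (g y))\<^sup>2)"
    proof (rule AE_I2)
      fix y
      have "2 * (norm (f y) * norm (g y)) \<le> (norm (f y))\<^sup>2 + (norm (g y))\<^sup>2"
        using sum_squares_bound[of "norm (f y)" "norm (g y)"] by (simp add: mult.assoc)
      moreover have "0 \<le> norm (f y) * norm (g y)" by simp
      ultimately have "norm (f y) * norm (g y) \<le> (norm (f y))\<^sup>2 + (norm (g y))\<^sup>2" by linarith
      then show "norm (f y * g y) \<le> norm ((norm (f y))\<^sup>2 + (norm (g y))\<^sup>2)"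
        unfolding norm_mult by simp
    qed
  qed
  define a b c where "a = (L2_norm f)\<^sup>2" and "b = (L2_norm g)\<^sup>2" and "c = (LINT y|leb_I. norm (f y * g y))"
  have in': "integrable leb_I (\<lambda>y. norm (f y * g y))" using ifg by simp
  have quad: "0 \<le> t\<^sup>2 * a - 2 * t * c + b" for t
  proof -
    have "0 \<le> (LINT y|leb_I. (t * norm (f y) - norm (g y))\<^sup>2)" by simp
    also have "\<dots> = (LINT y|leb_I. t\<^sup>2 * (norm (f y))\<^sup>2 - (2 * t) * norm (f y * g y) + (norm (g y))\<^sup>2)"
      by (simp add: power2_diff power_mult_distrib norm_mult algebra_simps)
    also have "\<dots> = t\<^sup>2 * a - 2 * t * c + b"
      using i in' by (simp add: a_def b_def c_def L2_norm_power2)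
    finally show ?thesis .
  qed
  have nonneg: "a \<ge> 0" "b \<ge> 0" "c \<ge> 0" by (simp_all add: a_def b_def c_def)
  have "c\<^sup>2 \<le> a * b"
  proof (cases "a = 0")
    case True
    have "c = 0"
    proof (rule ccontr)
      assume "c \<noteq> 0"
      \<comment> \<open>With \<open>a = 0\<close> the quadratic is affine in t, and at this t its
        value is -1.\<close>
      then show False using quad[of "(b + 1) / (2 * c)"] True by (simp add: field_simps)
    qed
    then show ?thesis using nonneg by simp
  next
    case False
    then have "a > 0" using nonneg by simp
    \<comment> \<open>The minimiser of the quadratic.\<close>
    then show ?thesis using quad[of "c / a"] by (simp add: field_simps power2_eq_square)
  qed
  also have "a * b = (L2_norm f * L2_norm g)\<^sup>2" by (simp add: a_def b_def power_mult_distrib)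
  finally show le: "(LINT y|leb_I. norm (f y * g y)) \<le> L2_norm f * L2_norm g"
    unfolding c_def by (rule power2_le_imp_le) (simp add: L2_norm_nonneg)
  have "norm (LINT y|leb_I. f y * g y) \<le> (LINT y|leb_I. norm (f y * g y))"
    by (rule integral_norm_bound)
  then show "norm (LINT y|leb_I. f y * g y) \<le> L2_norm f * L2_norm g" using le by (rule order_trans)
qed

section \<open>Boundary values and representatives\<close>

text \<open>The points of the open interval where two continuous functions differ form an open null
  set, hence none exist; closedness of the agreement set then reaches the endpoints. This transfers
  the boundary values between continuous representatives.\<close>

lemma AE_leb_I_eq_imp_eq:
  fixes f g :: "real \<Rightarrow> 'a :: real_normed_vector"
  assumes "AE y in leb_I. f y = g y" "continuous_on {-1..1} f" "continuous_on {-1..1} g" "y \<in> {-1..1}"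
  shows "f y = g y"
proof -
  define E where "E = {y \<in> {-1..1}. f y = g y}"
  have "closed {y \<in> {-1..1}. f y - g y = 0}"
    by (intro continuous_closed_preimage_constant continuous_intros assms)
  then have E: "closed E" by (simp add: E_def)
  have "AE y in lborel. y \<in> \<I> \<longrightarrow> y \<in> E"
    using assms(1) unfolding AE_leb_I_iff AE_completion_iff by eventually_elim (auto simp: E_def)
  then have "AE y in lborel. y \<notin> \<I> - E" by eventually_elim blast
  moreover have "\<I> - E \<in> sets lborel" using E by simp
  ultimately have "\<I> - E \<in> null_sets lborel" by (simp only: AE_iff_null_sets)
  moreover have "open (\<I> - E)" using E by auto
  ultimately have "\<I> - E = {}"
    using open_not_negligible negligible_iff_null_sets null_sets_completionI by metis
  then have "closure \<I> \<subseteq> E" using E by (intro closure_minimal) auto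
  then show ?thesis using assms(4) by (auto simp: E_def)
qed

lemma H2_AC_representative:
  assumes "f \<in> H\<^sup>2" "weak_deriv f f'" "weak_deriv f' f''" "zero_at_boundary f"
  obtains g g' g'' where "AC g g'" "AC g' g''" "g (-1) = 0" "g 1 = 0"
    "AE y in leb_I. f y = g y" "AE y in leb_I. f' y = g' y" "AE y in leb_I. f'' y = g'' y"
proof -
  obtain h h2 where h: "h \<in> L\<^sup>2" "h2 \<in> L\<^sup>2" "weak_deriv f h" "weak_deriv h h2"
    using assms(1) by (auto simp: H2_space_def)
  have e1: "AE y in leb_I. f' y = h y" by (rule weak_deriv_unique[OF assms(2) h(3)]) simp
  have e2: "AE y in leb_I. f'' y = h2 y" by (rule weak_deriv_unique[OF assms(3) h(4) e1])
  obtain g' where g': "AC g' h2" "AE y in leb_I. h y = g' y"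
    by (rule weak_deriv_imp_AC[OF h(4) L2_space_integrable[OF h(2)]])
  obtain g where g: "AC g h" "AE y in leb_I. f y = g y"
    by (rule weak_deriv_imp_AC[OF h(3) L2_space_integrable[OF h(1)]])
  \<comment> \<open>Replacing \<open>h\<close> by its continuous representative links the two
    levels: the derivative of \<open>g\<close> is now the very function that is absolutely
    continuous.\<close>
  have gg': "AC g g'"
    by (rule AC_cong_AE[OF g(1) g'(2)]) (rule integrable_leb_I_continuous[OF AC_continuous_on[OF g'(1)]])
  obtain b where b: "continuous_on {-1..1} b" "AE y in leb_I. b y = f y" "b (-1) = 0" "b 1 = 0"
    using assms(4) by (auto simp: zero_at_boundary_def)
  have bg: "AE y in leb_I. b y = g y" using b(2) g(2) by eventually_elim simp
  have "b y = g y" if "y \<in> {-1..1}" for y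
    by (rule AE_leb_I_eq_imp_eq[OF bg b(1) AC_continuous_on[OF gg'] that])
  from this[of "-1"] this[of 1] have "g (-1) = 0" "g 1 = 0" using b(3,4) by simp_all
  moreover have "AE y in leb_I. f' y = g' y" using e1 g'(2) by eventually_elim simp
  ultimately show thesis using that gg' g' g(2) e2 by blast
qed

subsection \<open>Energy estimates\<close>

lemma integral_times_cnj:
  "(LINT y|leb_I. f y * cnj (f y)) = of_real ((L2_norm f)\<^sup>2)"
  unfolding L2_norm_power2 by (simp add: complex_norm_square[symmetric] flip: of_real_power)

text \<open>Agmon's inequality: |f|^2 is the integral of its derivative from the endpoint where f
  vanishes, and that derivative is at most 2|f||f'|.\<close>

lemma norm_AC_squared_le:
  assumes "AC f f'" "continuous_on {-1..1} f'" "f (-1) = 0" "y \<in> {-1..1}"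
  shows "(norm (f y))\<^sup>2 \<le> 2 * L2_norm f * L2_norm f'"
proof -
  have c: "AC (\<lambda>y. f y * cnj (f y)) (\<lambda>y. f' y * cnj (f y) + f y * cnj (f' y))"
    by (rule AC_mult[OF assms(1) AC_cnj[OF assms(1)]])
  have L2: "f \<in> L\<^sup>2" "f' \<in> L\<^sup>2"
    using L2_space_continuous AC_continuous_on[OF assms(1)] assms(2) by auto
  have i: "integrable leb_I (\<lambda>y. norm (f y * f' y))"
    using Cauchy_Schwarz_L2(1)[OF L2] by simp
  have "(norm (f y))\<^sup>2 = norm (f y * cnj (f y))" by (simp add: norm_mult power2_eq_square)
  also have "\<dots> = norm (LINT t|leb_I. indicator {..y} t *\<^sub>R (f' t * cnj (f t) + f t * cnj (f' t)))"
    using c assms(3,4) by (auto simp: AC_def)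
  also have "\<dots> \<le> (LINT t|leb_I. 2 * norm (f t * f' t))"
  proof (rule Bochner_Integration.integral_norm_bound_integral)
    show "integrable leb_I (\<lambda>t. indicat_real {..y} t *\<^sub>R (f' t * cnj (f t) + f t * cnj (f' t)))"
      by (rule integrable_indicator_leb_I[OF AC_integrable[OF c]])
    show "integrable leb_I (\<lambda>t. 2 * norm (f t * f' t))" using i by simp
    fix t
    have "norm (f' t * cnj (f t) + f t * cnj (f' t)) \<le> 2 * norm (f t * f' t)"
      by (rule order_trans[OF norm_triangle_ineq]) (simp add: norm_mult mult.commute)
    then show "norm (indicat_real {..y} t *\<^sub>R (f' t * cnj (f t) + f t * cnj (f' t))) \<le> 2 * norm (f t * f' t)"
      by (simp add: indicator_def)
  qed
  also have "\<dots> \<le> 2 * (L2_norm f * L2_norm f')"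
    using Cauchy_Schwarz_L2(2)[OF L2] by simp
  finally show ?thesis by simp
qed

lemma resolvent_estimates:
  fixes \<nu> \<kappa> lam :: real
  assumes \<nu>: "\<nu> > 0" and F: "F \<in> L\<^sup>2"
    and w: "AC w w'" "AC w' w''" "w (-1) = 0" "w 1 = 0"
    and eq: "AE y in leb_I. - of_real \<nu> * (w'' y - (of_real \<kappa>)\<^sup>2 * w y)
               + \<i> * of_real \<kappa> * of_real (y - lam) * w y = F y"
  defines "W \<equiv> L2_norm w" and "D \<equiv> L2_norm w'" and "M \<equiv> L2_norm (\<lambda>y. of_real (y - lam) * w y)"
    and "N \<equiv> L2_norm F"
  shows "\<nu> * D\<^sup>2 \<le> N * W" "\<bar>\<kappa>\<bar> * M\<^sup>2 \<le> N * M + \<nu> * (D * W)" "W\<^sup>2 \<le> 2 * M * D"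
proof -
  note cont [continuous_intros] = AC_continuous_on[OF w(1)] AC_continuous_on[OF w(2)]
  define m where "m y = complex_of_real (y - lam)" for y
  have contm [continuous_intros]: "continuous_on S m" for S
    unfolding m_def by (intro continuous_intros)
  have ACm: "AC m (\<lambda>_. 1)"
    unfolding m_def by (rule AC_C1) (auto intro!: derivative_eq_intros)
  define v where "v y = m y * cnj (w y)" for y
  have ACw: "AC (\<lambda>y. cnj (w y)) (\<lambda>y. cnj (w' y))" by (rule AC_cnj[OF w(1)])
  have ACv: "AC v (\<lambda>y. 1 * cnj (w y) + m y * cnj (w' y))"
    unfolding v_def by (rule AC_mult[OF ACm ACw])
  have contv [continuous_intros]: "continuous_on {-1..1} v"
    by (rule AC_continuous_on[OF ACv])
  have int: "integrable leb_I f" if "continuous_on {-1..1} f" for f :: "real \<Rightarrow> complex"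
    using that by (rule integrable_leb_I_continuous)
  have iw'': "integrable leb_I (\<lambda>y. w'' y * q y)" if "continuous_on {-1..1} q" for q
    using bounded_times_integrable_leb_I[OF that AC_integrable[OF w(2)]] by (simp add: mult.commute)
  \<comment> \<open>The equation tested against an arbitrary continuous \<open>q\<close>; the
    multipliers \<open>cnj (w y)\<close> and \<open>v y\<close> are both instances.\<close>
  have test: "(LINT y|leb_I. F y * q y) =
      - of_real \<nu> * (LINT y|leb_I. w'' y * q y) + of_real (\<nu> * \<kappa>\<^sup>2) * (LINT y|leb_I. w y * q y)
      + \<i> * of_real \<kappa> * (LINT y|leb_I. m y * w y * q y)"
    if q: "continuous_on {-1..1} q" for q
  proof -
    have "(LINT y|leb_I. F y * q y) = (LINT y|leb_I. - of_real \<nu> * (w'' y * q y)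
        + of_real (\<nu> * \<kappa>\<^sup>2) * (w y * q y) + \<i> * of_real \<kappa> * (m y * w y * q y))"
    proof (rule integral_leb_I_cong_AE)
      show "(\<lambda>y. - of_real \<nu> * (w'' y * q y) + of_real (\<nu> * \<kappa>\<^sup>2) * (w y * q y)
        + \<i> * of_real \<kappa> * (m y * w y * q y)) \<in> borel_measurable leb_I"
        by (intro borel_measurable_integrable Bochner_Integration.integrable_add integrable_mult_right iw'' int continuous_intros q)
      show "AE y in leb_I. - of_real \<nu> * (w'' y * q y) + of_real (\<nu> * \<kappa>\<^sup>2) * (w y * q y)
        + \<i> * of_real \<kappa> * (m y * w y * q y) = F y * q y"
        using eq
      proof eventually_elim
        case (elim y)
        show ?case unfolding elim[symmetric] by (simp add: m_def algebra_simps)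
      qed
    qed
    also have "\<dots> = - of_real \<nu> * (LINT y|leb_I. w'' y * q y) + of_real (\<nu> * \<kappa>\<^sup>2) * (LINT y|leb_I. w y * q y)
      + \<i> * of_real \<kappa> * (LINT y|leb_I. m y * w y * q y)"
    proof -
      have "integrable leb_I (\<lambda>y. w'' y * q y)" "integrable leb_I (\<lambda>y. w y * q y)" "integrable leb_I (\<lambda>y. m y * w y * q y)"
        by (intro iw'' int continuous_intros q)+
      then show ?thesis by simp
    qed
    finally show ?thesis .
  qed
  have real_weight: "(LINT y|leb_I. m y * (f y * cnj (f y))) = of_real (LINT y|leb_I. (y - lam) * (norm (f y))\<^sup>2)" for f
  proof -
    have "m y * (f y * cnj (f y)) = of_real ((y - lam) * (norm (f y))\<^sup>2)" for y
      by (simp add: m_def complex_norm_square[symmetric])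
    then show ?thesis by (simp only: integral_complex_of_real)
  qed
  have L2w: "w \<in> L\<^sup>2" "w' \<in> L\<^sup>2" by (intro L2_space_continuous continuous_intros)+
  have L2cw: "(\<lambda>y. cnj (w y)) \<in> L\<^sup>2" "(\<lambda>y. cnj (w' y)) \<in> L\<^sup>2" by (intro L2_space_continuous continuous_intros)+
  have L2v: "v \<in> L\<^sup>2" "(\<lambda>y. m y * w y) \<in> L\<^sup>2" by (intro L2_space_continuous continuous_intros)+
  have norms: "L2_norm (\<lambda>y. cnj (w y)) = W" "L2_norm (\<lambda>y. cnj (w' y)) = D" "L2_norm v = M" "L2_norm (\<lambda>y. m y * w y) = M"
    by (simp_all add: W_def D_def M_def L2_norm_def v_def m_def norm_mult)
  have [simp]: "W \<ge> 0" "D \<ge> 0" "M \<ge> 0" "N \<ge> 0" by (simp_all add: W_def D_def M_def N_def L2_norm_nonneg)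

  have w''w: "(LINT y|leb_I. w'' y * cnj (w y)) = - of_real (D\<^sup>2)"
  proof -
    have "(LINT y|leb_I. w'' y * cnj (w y) + w' y * cnj (w' y)) = 0"
      using AC_diff_eq[OF AC_mult[OF w(2) ACw]] w(3,4) by simp
    moreover have "integrable leb_I (\<lambda>y. w'' y * cnj (w y))" "integrable leb_I (\<lambda>y. w' y * cnj (w' y))"
      by (intro iw'' int continuous_intros)+
    ultimately show ?thesis unfolding D_def integral_times_cnj[symmetric]
      by (simp add: eq_neg_iff_add_eq_0)
  qed
  have "(LINT y|leb_I. m y * w y * cnj (w y)) = of_real (LINT y|leb_I. (y - lam) * (norm (w y))\<^sup>2)"
    using real_weight[of w] by (simp add: mult.assoc)
  then have "Re (LINT y|leb_I. F y * cnj (w y)) = \<nu> * D\<^sup>2 + \<nu> * \<kappa>\<^sup>2 * W\<^sup>2"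
    by (subst test) (auto intro!: continuous_intros simp: w''w integral_times_cnj W_def)
  \<comment> \<open>The contribution of \<open>\<kappa>\<^sup>2\<close> has the good sign and is
    dropped.\<close>
  then have "\<nu> * D\<^sup>2 \<le> Re (LINT y|leb_I. F y * cnj (w y))" using \<nu> by simp
  also have "\<dots> \<le> norm (LINT y|leb_I. F y * cnj (w y))" by (rule complex_Re_le_cmod)
  also have "\<dots> \<le> N * W" using Cauchy_Schwarz_L2(3)[OF F L2cw(1)] by (simp add: norms N_def)
  finally show "\<nu> * D\<^sup>2 \<le> N * W" .

  have w''v: "(LINT y|leb_I. w'' y * v y) =
     - (LINT y|leb_I. w' y * cnj (w y)) - of_real (LINT y|leb_I. (y - lam) * (norm (w' y))\<^sup>2)"
  proof -
    have "(LINT y|leb_I. w'' y * v y + w' y * (1 * cnj (w y) + m y * cnj (w' y))) = 0"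
      using AC_diff_eq[OF AC_mult[OF w(2) ACv]] w(3,4) by (simp add: v_def)
    also have "(\<lambda>y. w'' y * v y + w' y * (1 * cnj (w y) + m y * cnj (w' y))) =
       (\<lambda>y. w'' y * v y + (w' y * cnj (w y) + m y * (w' y * cnj (w' y))))"
      by (simp add: algebra_simps)
    finally have "(LINT y|leb_I. w'' y * v y + (w' y * cnj (w y) + m y * (w' y * cnj (w' y)))) = 0" .
    moreover have "integrable leb_I (\<lambda>y. w'' y * v y)" "integrable leb_I (\<lambda>y. w' y * cnj (w y))"
      "integrable leb_I (\<lambda>y. m y * (w' y * cnj (w' y)))"
      by (intro iw'' int continuous_intros)+
    ultimately have "(LINT y|leb_I. w'' y * v y) + ((LINT y|leb_I. w' y * cnj (w y))
        + (LINT y|leb_I. m y * (w' y * cnj (w' y)))) = 0" by simp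
    then show ?thesis unfolding real_weight by (simp add: eq_neg_iff_add_eq_0 algebra_simps)
  qed
  have wv: "(LINT y|leb_I. w y * v y) = of_real (LINT y|leb_I. (y - lam) * (norm (w y))\<^sup>2)"
    using real_weight[of w] by (simp add: v_def algebra_simps)
  have mwv: "(LINT y|leb_I. m y * w y * v y) = of_real (M\<^sup>2)"
    using integral_times_cnj[of "\<lambda>y. m y * w y"] unfolding norms(4) by (simp add: v_def m_def)
  \<comment> \<open>Diffusion leaves only the commutator term with \<open>w' y * cnj (w y)\<close>,
    which arises from the derivative 1 of the weight; everything else in it is real.\<close>
  have "Im (LINT y|leb_I. F y * v y) = \<nu> * Im (LINT y|leb_I. w' y * cnj (w y)) + \<kappa> * M\<^sup>2"
    by (subst test) (auto intro!: contv simp: w''v wv mwv)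
  then have "\<kappa> * M\<^sup>2 = Im (LINT y|leb_I. F y * v y) - \<nu> * Im (LINT y|leb_I. w' y * cnj (w y))" by simp
  then have "\<bar>\<kappa> * M\<^sup>2\<bar> \<le> \<bar>Im (LINT y|leb_I. F y * v y)\<bar> + \<nu> * \<bar>Im (LINT y|leb_I. w' y * cnj (w y))\<bar>"
    using \<nu> by (simp add: abs_mult abs_triangle_ineq4 order_trans[OF abs_triangle_ineq4])
  also have "\<dots> \<le> norm (LINT y|leb_I. F y * v y) + \<nu> * norm (LINT y|leb_I. w' y * cnj (w y))"
    using \<nu> by (intro add_mono mult_left_mono abs_Im_le_cmod) auto
  also have "\<dots> \<le> N * M + \<nu> * (D * W)"
    using Cauchy_Schwarz_L2(3)[OF F L2v(1)] Cauchy_Schwarz_L2(3)[OF L2w(2) L2cw(1)] \<nu>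
    by (intro add_mono mult_left_mono) (auto simp: norms N_def D_def)
  finally show "\<bar>\<kappa>\<bar> * M\<^sup>2 \<le> N * M + \<nu> * (D * W)" by (simp add: abs_mult)

  have "(LINT y|leb_I. (1 * cnj (w y) + m y * cnj (w' y)) * w y + v y * w' y) = 0"
    using AC_diff_eq[OF AC_mult[OF ACv w(1)]] w(3,4) by simp
  also have "(\<lambda>y. (1 * cnj (w y) + m y * cnj (w' y)) * w y + v y * w' y) =
      (\<lambda>y. w y * cnj (w y) + (m y * w y * cnj (w' y) + v y * w' y))"
    by (simp add: algebra_simps)
  finally have "(LINT y|leb_I. w y * cnj (w y) + (m y * w y * cnj (w' y) + v y * w' y)) = 0" .
  moreover have "integrable leb_I (\<lambda>y. w y * cnj (w y))" "integrable leb_I (\<lambda>y. m y * w y * cnj (w' y))"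
    "integrable leb_I (\<lambda>y. v y * w' y)"
    by (intro int continuous_intros)+
  ultimately have "(LINT y|leb_I. w y * cnj (w y)) + ((LINT y|leb_I. m y * w y * cnj (w' y))
      + (LINT y|leb_I. v y * w' y)) = 0" by simp
  then have "of_real (W\<^sup>2) = - ((LINT y|leb_I. m y * w y * cnj (w' y)) + (LINT y|leb_I. v y * w' y))"
    unfolding integral_times_cnj W_def by (simp only: eq_neg_iff_add_eq_0)
  then have "W\<^sup>2 = norm ((LINT y|leb_I. m y * w y * cnj (w' y)) + (LINT y|leb_I. v y * w' y))"
    by (metis norm_minus_cancel norm_of_real abs_power2)
  also have "\<dots> \<le> norm (LINT y|leb_I. m y * w y * cnj (w' y)) + norm (LINT y|leb_I. v y * w' y)"
    by (rule norm_triangle_ineq)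
  also have "\<dots> \<le> M * D + M * D"
    using Cauchy_Schwarz_L2(3)[OF L2v(2) L2cw(2)] Cauchy_Schwarz_L2(3)[OF L2v(1) L2w(2)]
    by (intro add_mono) (simp_all add: norms D_def)
  finally show "W\<^sup>2 \<le> 2 * M * D" by (simp add: mult.commute mult.left_commute)
qed

section \<open>The L1 norm of the vorticity and the size of the velocity\<close>

lemma L1_norm_le_weighted:
  fixes \<delta> lam :: real and w :: "real \<Rightarrow> complex"
  assumes w: "continuous_on {-1..1} w" and \<delta>: "\<delta> > 0"
  shows "(L1_norm w)\<^sup>2 \<le> pi / \<delta> * (\<delta>\<^sup>2 * (L2_norm w)\<^sup>2 + (L2_norm (\<lambda>y. of_real (y - lam) * w y))\<^sup>2)"
proof -
  define \<rho> where "\<rho> y = sqrt (\<delta>\<^sup>2 + (y - lam)\<^sup>2)" for y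
  have pos: "\<delta>\<^sup>2 + (y - lam)\<^sup>2 > 0" for y using \<delta> by (simp add: add_pos_nonneg)
  then have \<rho>: "\<rho> y > 0" "(\<rho> y)\<^sup>2 = \<delta>\<^sup>2 + (y - lam)\<^sup>2" for y by (simp_all add: \<rho>_def less_imp_le)
  have cont\<rho>: "continuous_on S \<rho>" for S unfolding \<rho>_def by (intro continuous_intros)
  define f where "f y = complex_of_real (\<rho> y) * w y" for y
  define g where "g y = complex_of_real (1 / \<rho> y)" for y
  have cf: "continuous_on {-1..1} f" unfolding f_def by (intro continuous_intros cont\<rho> w)
  have cg: "continuous_on {-1..1} g" unfolding g_def using \<rho>(1) by (intro continuous_intros cont\<rho>) (metis less_irrefl)
  have "L1_norm w = (LINT y|leb_I. norm (f y * g y))"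
    unfolding L1_norm_def f_def g_def using \<rho>(1) by (intro Bochner_Integration.integral_cong refl) (simp add: norm_mult norm_divide less_imp_neq[symmetric])
  also have "\<dots> \<le> L2_norm f * L2_norm g"
    by (rule Cauchy_Schwarz_L2(2)[OF L2_space_continuous[OF cf] L2_space_continuous[OF cg]])
  finally have "L1_norm w \<le> L2_norm f * L2_norm g" .
  moreover have "0 \<le> L1_norm w" by (simp add: L1_norm_def)
  ultimately have "(L1_norm w)\<^sup>2 \<le> (L2_norm f * L2_norm g)\<^sup>2" by (rule power_mono)
  also have "\<dots> = (L2_norm g)\<^sup>2 * (L2_norm f)\<^sup>2" by (simp add: power_mult_distrib)
  also have "(L2_norm f)\<^sup>2 = \<delta>\<^sup>2 * (L2_norm w)\<^sup>2 + (L2_norm (\<lambda>y. of_real (y - lam) * w y))\<^sup>2"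
  proof -
    have i: "integrable leb_I (\<lambda>y. (norm (w y))\<^sup>2)" "integrable leb_I (\<lambda>y. (norm (of_real (y - lam) * w y))\<^sup>2)"
      using w by (auto intro!: integrable_leb_I_continuous continuous_intros)
    have "(norm (f y))\<^sup>2 = \<delta>\<^sup>2 * (norm (w y))\<^sup>2 + (norm (of_real (y - lam) * w y))\<^sup>2" for y
      unfolding f_def norm_mult power_mult_distrib norm_of_real by (simp add: \<rho>(2) algebra_simps)
    then show ?thesis unfolding L2_norm_power2 using i by simp
  qed
  \<comment> \<open>The reciprocal weight has the primitive arctan((y -
    \<lambda>)/\<delta>)/\<delta>, whose total variation is at most \<pi>/\<delta> whatever
    \<lambda> is.\<close>
  also have "(L2_norm g)\<^sup>2 \<le> pi / \<delta>"
  proof -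
    have deriv: "((\<lambda>y. arctan ((y - lam) / \<delta>) / \<delta>) has_vector_derivative (norm (g y))\<^sup>2) (at y within {-1..1})" for y
    proof -
      have "1 / (\<rho> y)\<^sup>2 = 1 / (1 + ((y - lam) / \<delta>)\<^sup>2) * (1 / \<delta>) / \<delta>"
      proof -
        have "1 + ((y - lam) / \<delta>)\<^sup>2 = (\<rho> y)\<^sup>2 / \<delta>\<^sup>2"
          unfolding \<rho>(2) using \<delta> by (simp add: power_divide add_divide_distrib)
        then show ?thesis using \<delta> by (simp add: power2_eq_square)
      qed
      also have "1 / (\<rho> y)\<^sup>2 = (norm (g y))\<^sup>2"
        by (simp add: g_def norm_divide power_divide)
      finally have norm_g: "(norm (g y))\<^sup>2 = 1 / (1 + ((y - lam) / \<delta>)\<^sup>2) * (1 / \<delta>) / \<delta>" .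
      show ?thesis unfolding has_real_derivative_iff_has_vector_derivative[symmetric] norm_g
        using \<delta> by (auto intro!: derivative_eq_intros simp: divide_inverse)
    qed
    have "integrable leb_I (\<lambda>y. (norm (g y))\<^sup>2)"
      by (intro integrable_leb_I_continuous continuous_intros cg)
    then have "(L2_norm g)\<^sup>2 = integral {-1..1} (\<lambda>y. (norm (g y))\<^sup>2)"
      unfolding L2_norm_power2 by (subst lebesgue_integral_eq_integral) (simp_all add: integral_open_interval_real)
    also have "\<dots> = arctan ((1 - lam) / \<delta>) / \<delta> - arctan ((-1 - lam) / \<delta>) / \<delta>"
      by (intro integral_unique fundamental_theorem_of_calculus deriv) auto
    also have "\<dots> \<le> (pi / 2) / \<delta> - (- (pi / 2)) / \<delta>"
      using \<delta> arctan_ubound arctan_lbound by (intro diff_mono divide_right_mono) (auto intro: less_imp_le)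
    finally show ?thesis by (simp add: field_simps)
  qed
  finally show ?thesis by (simp add: mult_right_mono)
qed

text \<open>Duality between the L1 norm and the supremum: pairing the equation with \<phi> expresses
  \<open>U\<^sup>2\<close> through w and \<phi>, and since |\<phi>| is at most
  \<open>U / sqrt \<bar>\<kappa>\<bar>\<close>, one factor \<open>U\<close> cancels.\<close>

lemma stream_function_estimate:
  fixes \<kappa> :: real
  assumes \<phi>: "AC \<phi> \<phi>'" "AC \<phi>' \<phi>''" "\<phi> (-1) = 0" "\<phi> 1 = 0" and w: "continuous_on {-1..1} w"
    and eq: "AE y in leb_I. \<phi>'' y - (of_real \<kappa>)\<^sup>2 * \<phi> y = w y" and \<kappa>: "\<kappa> \<noteq> 0"
  shows "sqrt \<bar>\<kappa>\<bar> * sqrt ((L2_norm \<phi>')\<^sup>2 + \<kappa>\<^sup>2 * (L2_norm \<phi>)\<^sup>2) \<le> L1_norm w"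
proof -
  note cont [continuous_intros] = AC_continuous_on[OF \<phi>(1)] AC_continuous_on[OF \<phi>(2)] w
  define U where "U = sqrt ((L2_norm \<phi>')\<^sup>2 + \<kappa>\<^sup>2 * (L2_norm \<phi>)\<^sup>2)"
  have U2: "U\<^sup>2 = (L2_norm \<phi>')\<^sup>2 + \<kappa>\<^sup>2 * (L2_norm \<phi>)\<^sup>2" and U0: "U \<ge> 0" by (simp_all add: U_def)
  have "(LINT y|leb_I. w y * cnj (\<phi> y)) = (LINT y|leb_I. \<phi>'' y * cnj (\<phi> y) - of_real (\<kappa>\<^sup>2) * (\<phi> y * cnj (\<phi> y)))"
  proof (rule sym, rule integral_leb_I_cong_AE)
    show "(\<lambda>y. w y * cnj (\<phi> y)) \<in> borel_measurable leb_I"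
      by (intro borel_measurable_leb_I_continuous continuous_intros)
    show "AE y in leb_I. w y * cnj (\<phi> y) = \<phi>'' y * cnj (\<phi> y) - of_real (\<kappa>\<^sup>2) * (\<phi> y * cnj (\<phi> y))"
      using eq
    proof eventually_elim
      case (elim y)
      show ?case unfolding elim[symmetric] by (simp add: algebra_simps)
    qed
  qed
  also have "\<dots> = - of_real (U\<^sup>2)"
  proof -
    have "(LINT y|leb_I. \<phi>'' y * cnj (\<phi> y) + \<phi>' y * cnj (\<phi>' y)) = 0"
      using AC_diff_eq[OF AC_mult[OF \<phi>(2) AC_cnj[OF \<phi>(1)]]] \<phi>(3,4) by simp
    moreover have i: "integrable leb_I (\<lambda>y. \<phi>'' y * cnj (\<phi> y))"
      using bounded_times_integrable_leb_I[OF _ AC_integrable[OF \<phi>(2)], of "\<lambda>y. cnj (\<phi> y)"]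
      by (simp add: mult.commute continuous_intros)
    moreover have j: "integrable leb_I (\<lambda>y. \<phi>' y * cnj (\<phi>' y))" "integrable leb_I (\<lambda>y. \<phi> y * cnj (\<phi> y))"
      by (intro integrable_leb_I_continuous continuous_intros)+
    ultimately have "(LINT y|leb_I. \<phi>'' y * cnj (\<phi> y)) = - of_real ((L2_norm \<phi>')\<^sup>2)"
      unfolding integral_times_cnj[symmetric] by (simp add: eq_neg_iff_add_eq_0)
    then show ?thesis using i j integral_times_cnj[of \<phi>] by (simp add: U2)
  qed
  finally have "U\<^sup>2 = norm (LINT y|leb_I. w y * cnj (\<phi> y))"
    by (metis norm_minus_cancel norm_of_real abs_power2)
  also have "\<dots> \<le> (LINT y|leb_I. (U / sqrt \<bar>\<kappa>\<bar>) * norm (w y))"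
  proof (rule Bochner_Integration.integral_norm_bound_integral)
    show "integrable leb_I (\<lambda>y. w y * cnj (\<phi> y))" "integrable leb_I (\<lambda>y. (U / sqrt \<bar>\<kappa>\<bar>) * norm (w y))"
      by (intro integrable_leb_I_continuous continuous_intros; simp)+
    fix y assume "y \<in> space leb_I"
    then have "(norm (\<phi> y))\<^sup>2 \<le> 2 * L2_norm \<phi> * L2_norm \<phi>'"
      by (intro norm_AC_squared_le \<phi> continuous_intros) auto
    then have "\<bar>\<kappa>\<bar> * (norm (\<phi> y))\<^sup>2 \<le> \<bar>\<kappa>\<bar> * (2 * L2_norm \<phi> * L2_norm \<phi>')"
      by (intro mult_left_mono) auto
    also have "\<dots> = 2 * L2_norm \<phi>' * (\<bar>\<kappa>\<bar> * L2_norm \<phi>)" by simp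
    \<comment> \<open>The factor 2 of the pointwise bound is exactly what the arithmetic-geometric
      mean inequality absorbs.\<close>
    also have "\<dots> \<le> (L2_norm \<phi>')\<^sup>2 + (\<bar>\<kappa>\<bar> * L2_norm \<phi>)\<^sup>2" by (rule sum_squares_bound)
    also have "\<dots> = U\<^sup>2" by (simp add: U2 power_mult_distrib)
    finally have "(norm (\<phi> y))\<^sup>2 \<le> (U / sqrt \<bar>\<kappa>\<bar>)\<^sup>2"
      using \<kappa> by (simp add: power_divide field_simps)
    then have "norm (\<phi> y) \<le> U / sqrt \<bar>\<kappa>\<bar>" by (rule power2_le_imp_le) (simp add: U0)
    then have "norm (w y) * norm (\<phi> y) \<le> norm (w y) * (U / sqrt \<bar>\<kappa>\<bar>)" by (intro mult_left_mono) auto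
    then show "norm (w y * cnj (\<phi> y)) \<le> (U / sqrt \<bar>\<kappa>\<bar>) * norm (w y)" by (simp add: norm_mult mult.commute)
  qed
  also have "\<dots> = (U / sqrt \<bar>\<kappa>\<bar>) * L1_norm w" by (simp add: L1_norm_def)
  finally have "U * (sqrt \<bar>\<kappa>\<bar> * U) \<le> U * L1_norm w" using \<kappa> by (simp add: power2_eq_square field_simps)
  moreover have "0 \<le> L1_norm w" by (simp add: L1_norm_def)
  ultimately have "sqrt \<bar>\<kappa>\<bar> * U \<le> L1_norm w"
    using U0 by (cases "U = 0") auto
  then show ?thesis by (simp add: U_def)
qed

section \<open>Elimination of the parameters\<close>

text \<open>The system closes because, when N is small against w, the first two inequalities make
  d^2 and m^2 such small multiples of w^2 that w^4 <= 4 m^2 d^2 fails.\<close>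

lemma scaled_estimates:
  fixes d m w N :: real
  assumes nonneg: "0 \<le> d" "0 \<le> m" "0 \<le> w" "0 \<le> N"
    and d: "d\<^sup>2 \<le> N * w" and m: "m\<^sup>2 \<le> N * m + d * w" and w: "w\<^sup>2 \<le> 2 * m * d"
  shows "w \<le> 9 * N" "d \<le> 3 * N" "m \<le> 8 * N"
proof -
  \<comment> \<open>Half of \<open>m\<^sup>2\<close> is absorbed on the left by Young's
    inequality.\<close>
  have m': "m\<^sup>2 \<le> N\<^sup>2 + 2 * (d * w)"
    using m sum_squares_bound[of N m] by simp
  show w9: "w \<le> 9 * N"
  proof (rule ccontr)
    assume "\<not> w \<le> 9 * N"
    then have gt: "N < w / 9" by simp
    then have w0: "0 < w" using nonneg by simp
    have "N * w \<le> (w / 9) * w" using gt w0 by (intro mult_right_mono) auto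
    with d have "d\<^sup>2 \<le> (w / 9) * w" by (rule order_trans)
    then have d2: "d\<^sup>2 \<le> w\<^sup>2 / 9" by (simp add: power2_eq_square)
    then have "d\<^sup>2 \<le> (w / 3)\<^sup>2" by (simp add: power_divide)
    then have "d \<le> w / 3" by (rule power2_le_imp_le) (use nonneg in simp)
    then have dw: "d * w \<le> w\<^sup>2 / 3" using mult_right_mono[of d "w / 3" w] nonneg by (simp add: power2_eq_square)
    have "N\<^sup>2 \<le> (w / 9)\<^sup>2" using gt nonneg by (intro power_mono) auto
    then have m2: "m\<^sup>2 \<le> (55 / 81) * w\<^sup>2" using m' dw by (simp add: power_divide)
    have "(w\<^sup>2)\<^sup>2 \<le> (2 * m * d)\<^sup>2" using w by (intro power_mono) auto
    also have "\<dots> = 4 * (m\<^sup>2 * d\<^sup>2)" by (simp add: power_mult_distrib)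
    \<comment> \<open>Here 55/81 = 1/81 + 2/3, and 4 * 55 / 729 = 220/729 is below 1. The threshold
      9 is a square, so that \<open>d \<le> w / 3\<close> comes out without roots.\<close>
    also have "\<dots> \<le> 4 * (((55 / 81) * w\<^sup>2) * (w\<^sup>2 / 9))"
      using m2 d2 by (intro mult_left_mono mult_mono) auto
    also have "\<dots> < (w\<^sup>2)\<^sup>2" using w0 by (simp add: power2_eq_square)
    finally show False by simp
  qed
  have "d\<^sup>2 \<le> (3 * N)\<^sup>2"
    using d mult_left_mono[OF w9 nonneg(4)] by (simp add: power2_eq_square)
  then show d3: "d \<le> 3 * N" by (rule power2_le_imp_le) (use nonneg in simp)
  have "d * w \<le> (3 * N) * (9 * N)" using d3 w9 nonneg by (intro mult_mono) auto
  \<comment> \<open>The coefficient is 1 + 2 * 27, rounded up to 64 below.\<close>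
  then have "m\<^sup>2 \<le> 55 * N\<^sup>2" using m' by (simp add: power2_eq_square)
  also have "\<dots> \<le> (8 * N)\<^sup>2" by (simp add: power_mult_distrib)
  finally show "m \<le> 8 * N" by (rule power2_le_imp_le) (use nonneg in simp)
qed

text \<open>In terms of \<open>x = \<nu>\<^sup>1\<^sup>/\<^sup>3\<close> and \<open>\<kappa> = K\<^sup>1\<^sup>/\<^sup>3\<close>, the quantities \<open>x\<kappa>\<^sup>2W\<close>, \<open>x\<^sup>2\<kappa>D\<close>, \<open>\<kappa>\<^sup>3M\<close> satisfy inequalities without
  parameters.\<close>

lemma combine_estimates:
  fixes \<nu> K N W D M A U :: real
  assumes pos: "\<nu> > 0" "K > 0"
    and nonneg: "0 \<le> N" "0 \<le> W" "0 \<le> D" "0 \<le> M" "0 \<le> A" "0 \<le> U"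
    and h1: "\<nu> * D\<^sup>2 \<le> N * W" and h2: "K * M\<^sup>2 \<le> N * M + \<nu> * (D * W)" and h3: "W\<^sup>2 \<le> 2 * M * D"
    and h4: "\<And>\<delta>. \<delta> > 0 \<Longrightarrow> A\<^sup>2 \<le> pi / \<delta> * (\<delta>\<^sup>2 * W\<^sup>2 + M\<^sup>2)"
    and h5: "sqrt K * U \<le> A"
  shows "\<nu> powr (1/6) * K powr (4/3) * U + \<nu> powr (1/6) * K powr (5/6) * A
    + \<nu> powr (2/3) * K powr (1/3) * D + (\<nu> * K\<^sup>2) powr (1/3) * W + K * M \<le> 70 * N"
proof -
  define x \<kappa> where "x = \<nu> powr (1/3)" and "\<kappa> = K powr (1/3)"
  have x0: "x > 0" and \<kappa>0: "\<kappa> > 0" using pos by (auto simp: x_def \<kappa>_def)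
  have \<nu>: "\<nu> = x ^ 3" and K: "K = \<kappa> ^ 3"
    using pos by (simp_all add: x_def \<kappa>_def powr_power)
  define d m w where "d = x\<^sup>2 * \<kappa> * D" and "m = \<kappa> ^ 3 * M" and "w = x * \<kappa>\<^sup>2 * W"
  have nn: "0 \<le> d" "0 \<le> m" "0 \<le> w" using nonneg x0 \<kappa>0 by (simp_all add: d_def m_def w_def)
  have "d\<^sup>2 = x * \<kappa>\<^sup>2 * (\<nu> * D\<^sup>2)"
    by (simp add: d_def \<nu> power_mult_distrib eval_nat_numeral)
  also have "\<dots> \<le> x * \<kappa>\<^sup>2 * (N * W)" using h1 x0 by (intro mult_left_mono) auto
  finally have d: "d\<^sup>2 \<le> N * w" by (simp add: w_def mult_ac)
  have "m\<^sup>2 = \<kappa> ^ 3 * (K * M\<^sup>2)" by (simp add: m_def K power_mult_distrib eval_nat_numeral)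
  also have "\<dots> \<le> \<kappa> ^ 3 * (N * M + \<nu> * (D * W))" using h2 \<kappa>0 by (intro mult_left_mono) auto
  also have "\<dots> = N * m + d * w" by (simp add: m_def d_def w_def \<nu> eval_nat_numeral algebra_simps)
  finally have m: "m\<^sup>2 \<le> N * m + d * w" .
  have "w\<^sup>2 = x\<^sup>2 * \<kappa> ^ 4 * W\<^sup>2" by (simp add: w_def power_mult_distrib eval_nat_numeral)
  also have "\<dots> \<le> x\<^sup>2 * \<kappa> ^ 4 * (2 * M * D)" using h3 by (intro mult_left_mono) auto
  also have "\<dots> = 2 * m * d" by (simp add: m_def d_def eval_nat_numeral)
  finally have w: "w\<^sup>2 \<le> 2 * m * d" .
  note bounds = scaled_estimates[OF nn nonneg(1) d m w]
  define l where "l = \<nu> powr (1/6) * K powr (5/6) * A"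
  have "(\<nu> powr (1/6))\<^sup>2 = x" "(K powr (5/6))\<^sup>2 = \<kappa> ^ 5"
    using pos by (simp_all add: x_def \<kappa>_def powr_power)
  then have "l\<^sup>2 = x * \<kappa> ^ 5 * A\<^sup>2" by (simp add: l_def power_mult_distrib)
  \<comment> \<open>The choice \<delta> = x/\<kappa> = (\<nu>/K)^(1/3) gives
    \<open>\<delta>\<^sup>2 * W\<^sup>2\<close> and \<open>M\<^sup>2\<close> the same scale:
    multiplied by \<open>\<kappa> ^ 6\<close> they become \<open>w\<^sup>2\<close> and
    \<open>m\<^sup>2\<close>.\<close>
  also have "\<dots> \<le> x * \<kappa> ^ 5 * (pi / (x / \<kappa>) * ((x / \<kappa>)\<^sup>2 * W\<^sup>2 + M\<^sup>2))"
    using x0 \<kappa>0 by (intro mult_left_mono h4) auto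
  also have "\<dots> = pi * (w\<^sup>2 + m\<^sup>2)"
    using x0 \<kappa>0 by (simp add: w_def m_def field_simps eval_nat_numeral)
  \<comment> \<open>With \<pi> < 4 the coefficient is 4 * (81 + 64) = 580, below 25^2 = 625.\<close>
  also have "\<dots> \<le> 4 * ((9 * N)\<^sup>2 + (8 * N)\<^sup>2)"
    using bounds nn pi_less_4 by (intro mult_mono add_mono power_mono) auto
  also have "\<dots> \<le> (25 * N)\<^sup>2" by (simp add: power_mult_distrib)
  finally have l: "l \<le> 25 * N" by (rule power2_le_imp_le) (use nonneg in simp)
  \<comment> \<open>The velocity term carries an extra factor \<open>sqrt K\<close> compared with
    the L1 term, exactly the gain in \<open>h5\<close>, so both obey the same bound.\<close>
  have "K powr (4/3) = K powr (5/6) * sqrt K"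
    using pos by (simp add: powr_half_sqrt[symmetric] flip: powr_add)
  then have "\<nu> powr (1/6) * K powr (4/3) * U = \<nu> powr (1/6) * K powr (5/6) * (sqrt K * U)" by simp
  also have "\<dots> \<le> l" unfolding l_def using h5 by (intro mult_left_mono) auto
  finally have u: "\<nu> powr (1/6) * K powr (4/3) * U \<le> 25 * N" using l by simp
  have "\<nu> powr (2/3) = x\<^sup>2" using pos by (simp add: x_def powr_power)
  then have 3: "\<nu> powr (2/3) * K powr (1/3) * D = d" by (simp add: d_def \<kappa>_def)
  have "(\<nu> * K\<^sup>2) powr (1/3) = x * \<kappa>\<^sup>2"
    using pos by (simp add: powr_mult x_def \<kappa>_def powr_power powr_powr flip: powr_numeral)
  then have 4: "(\<nu> * K\<^sup>2) powr (1/3) * W = w" by (simp add: w_def)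
  have 5: "K * M = m" by (simp add: m_def K)
  \<comment> \<open>The constant is 70 = 25 + 25 + 3 + 9 + 8.\<close>
  show ?thesis using u l bounds unfolding 3 4 5 l_def by linarith
qed

text \<open>The derivatives of w and \<phi> are quantified as arbitrary weak derivatives and \<phi>
  as an arbitrary solution of its boundary value problem, so the estimate holds for every choice of
  representatives.\<close>

theorem proposition3p1:
  "\<exists>C::real. C > 0 \<and>
     (\<forall>(\<nu>::real) (k::int) (lam::real) (F::real \<Rightarrow> complex)
        (w::real \<Rightarrow> complex) w' w'' (\<phi>::real \<Rightarrow> complex) \<phi>' \<phi>''.
        0 < \<nu> \<and> \<nu> \<le> 1 \<and> \<bar>k\<bar> \<ge> 1 \<and> F \<in> L\<^sup>2 \<and>
        w \<in> H\<^sup>2 \<and> weak_deriv w w' \<and> weak_deriv w' w'' \<and>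
        (AE y in lebesgue_on \<I>.
           - of_real \<nu> * (w'' y - (of_int k)\<^sup>2 * w y)
             + \<i> * of_int k * of_real (y - lam) * w y = F y) \<and>
        zero_at_boundary w \<and>
        \<phi> \<in> H\<^sup>2 \<and> weak_deriv \<phi> \<phi>' \<and> weak_deriv \<phi>' \<phi>'' \<and>
        (AE y in lebesgue_on \<I>. \<phi>'' y - (of_int k)\<^sup>2 * \<phi> y = w y) \<and>
        zero_at_boundary \<phi>
        \<longrightarrow>
        \<nu> powr (1/6) * \<bar>of_int k\<bar> powr (4/3) * L2_norm (\<lambda>y. (\<phi>' y, - \<i> * of_int k * \<phi> y))
        + \<nu> powr (1/6) * \<bar>of_int k\<bar> powr (5/6) * L1_norm w
        + \<nu> powr (2/3) * \<bar>of_int k\<bar> powr (1/3) * L2_norm w'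
        + (\<nu> * (of_int k)\<^sup>2) powr (1/3) * L2_norm w
        + \<bar>of_int k\<bar> * L2_norm (\<lambda>y. of_real (y - lam) * w y)
        \<le> C * L2_norm F)"
proof (intro exI[of _ 70] conjI allI impI; (elim conjE)?)
  show "(0::real) < 70" by simp
  fix \<nu> lam :: real and k :: int and F w w' w'' \<phi> \<phi>' \<phi>'' :: "real \<Rightarrow> complex"
  assume \<nu>: "0 < \<nu>" and k: "1 \<le> \<bar>k\<bar>" and F: "F \<in> L\<^sup>2"
    and w: "w \<in> H\<^sup>2" "weak_deriv w w'" "weak_deriv w' w''" "zero_at_boundary w"
    and eq: "AE y in leb_I. - of_real \<nu> * (w'' y - (of_int k)\<^sup>2 * w y)
             + \<i> * of_int k * of_real (y - lam) * w y = F y"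
    and \<phi>: "\<phi> \<in> H\<^sup>2" "weak_deriv \<phi> \<phi>'" "weak_deriv \<phi>' \<phi>''" "zero_at_boundary \<phi>"
    and eq\<phi>: "AE y in leb_I. \<phi>'' y - (of_int k)\<^sup>2 * \<phi> y = w y"
  obtain v v' v'' where v: "AC v v'" "AC v' v''" "v (-1) = 0" "v 1 = 0"
    and vw: "AE y in leb_I. w y = v y" "AE y in leb_I. w' y = v' y" "AE y in leb_I. w'' y = v'' y"
    by (rule H2_AC_representative[OF w])
  obtain \<psi> \<psi>' \<psi>'' where \<psi>: "AC \<psi> \<psi>'" "AC \<psi>' \<psi>''" "\<psi> (-1) = 0" "\<psi> 1 = 0"
    and \<psi>\<phi>: "AE y in leb_I. \<phi> y = \<psi> y" "AE y in leb_I. \<phi>' y = \<psi>' y" "AE y in leb_I. \<phi>'' y = \<psi>'' y"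
    by (rule H2_AC_representative[OF \<phi>])
  define \<kappa> where "\<kappa> = real_of_int k"
  have \<kappa>: "\<bar>\<kappa>\<bar> > 0" "\<kappa> \<noteq> 0" using k by (auto simp: \<kappa>_def)
  note cont [continuous_intros] = AC_continuous_on[OF v(1)] AC_continuous_on[OF v(2)]
    AC_continuous_on[OF \<psi>(1)] AC_continuous_on[OF \<psi>(2)]
  have eqv: "AE y in leb_I. - of_real \<nu> * (v'' y - (of_real \<kappa>)\<^sup>2 * v y)
             + \<i> * of_real \<kappa> * of_real (y - lam) * v y = F y"
    using eq vw(1,3) by eventually_elim (simp add: \<kappa>_def)
  have eq\<psi>: "AE y in leb_I. \<psi>'' y - (of_real \<kappa>)\<^sup>2 * \<psi> y = v y"
    using eq\<phi> vw(1) \<psi>\<phi>(1,3) by eventually_elim (simp add: \<kappa>_def)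
  define U where "U = sqrt ((L2_norm \<psi>')\<^sup>2 + \<kappa>\<^sup>2 * (L2_norm \<psi>)\<^sup>2)"
  have "\<nu> powr (1/6) * \<bar>\<kappa>\<bar> powr (4/3) * U + \<nu> powr (1/6) * \<bar>\<kappa>\<bar> powr (5/6) * L1_norm v
    + \<nu> powr (2/3) * \<bar>\<kappa>\<bar> powr (1/3) * L2_norm v' + (\<nu> * \<bar>\<kappa>\<bar>\<^sup>2) powr (1/3) * L2_norm v
    + \<bar>\<kappa>\<bar> * L2_norm (\<lambda>y. of_real (y - lam) * v y) \<le> 70 * L2_norm F"
  proof (rule combine_estimates[OF \<nu> \<kappa>(1)])
    show "sqrt \<bar>\<kappa>\<bar> * U \<le> L1_norm v"
      unfolding U_def by (intro stream_function_estimate[OF \<psi> _ eq\<psi> \<kappa>(2)] continuous_intros)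
    show "(L1_norm v)\<^sup>2 \<le> pi / \<delta> * (\<delta>\<^sup>2 * (L2_norm v)\<^sup>2 + (L2_norm (\<lambda>y. of_real (y - lam) * v y))\<^sup>2)"
      if "\<delta> > 0" for \<delta>
      using that by (intro L1_norm_le_weighted continuous_intros)
  qed (use resolvent_estimates[OF \<nu> F v eqv] in \<open>simp_all add: L2_norm_nonneg L1_norm_def U_def\<close>)
  moreover have "L2_norm (\<lambda>y. (\<phi>' y, - \<i> * of_int k * \<phi> y)) = U"
  proof -
    have "L2_norm (\<lambda>y. (\<phi>' y, - \<i> * of_int k * \<phi> y)) = L2_norm (\<lambda>y. (\<psi>' y, - \<i> * of_int k * \<psi> y))"
    proof (rule L2_norm_cong_AE)
      show "(\<lambda>y. (\<psi>' y, - \<i> * of_int k * \<psi> y)) \<in> borel_measurable leb_I"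
        by (intro borel_measurable_leb_I_continuous continuous_intros)
      show "AE y in leb_I. (\<phi>' y, - \<i> * of_int k * \<phi> y) = (\<psi>' y, - \<i> * of_int k * \<psi> y)"
        using \<psi>\<phi>(1,2) by eventually_elim simp
    qed
    \<comment> \<open>The norm on pairs is Hermitian, so the squared components add up, and the
      factor \<open>- \<i> * of_int k\<close> contributes \<open>\<kappa>\<^sup>2\<close>.\<close>
    also have "\<dots> = U"
    proof -
      have "integrable leb_I (\<lambda>y. (norm (\<psi>' y))\<^sup>2)" "integrable leb_I (\<lambda>y. (norm (\<psi> y))\<^sup>2)"
        by (intro integrable_leb_I_continuous continuous_intros)+
      then show ?thesis
        unfolding U_def L2_norm_power2 unfolding L2_norm_def
        by (simp add: norm_Pair norm_mult power_mult_distrib \<kappa>_def)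
    qed
    finally show ?thesis .
  qed
  moreover have "L1_norm w = L1_norm v" "L2_norm w = L2_norm v" "L2_norm w' = L2_norm v'"
    by (intro L1_norm_cong_AE L2_norm_cong_AE borel_measurable_leb_I_continuous continuous_intros vw)+
  moreover have "L2_norm (\<lambda>y. of_real (y - lam) * w y) = L2_norm (\<lambda>y. of_real (y - lam) * v y)"
  proof (rule L2_norm_cong_AE)
    show "(\<lambda>y. of_real (y - lam) * v y) \<in> borel_measurable leb_I"
      by (intro borel_measurable_leb_I_continuous continuous_intros)
    show "AE y in leb_I. of_real (y - lam) * w y = of_real (y - lam) * v y"
      using vw(1) by eventually_elim simp
  qed
  ultimately show "\<nu> powr (1/6) * \<bar>of_int k\<bar> powr (4/3) * L2_norm (\<lambda>y. (\<phi>' y, - \<i> * of_int k * \<phi> y))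
        + \<nu> powr (1/6) * \<bar>of_int k\<bar> powr (5/6) * L1_norm w
        + \<nu> powr (2/3) * \<bar>of_int k\<bar> powr (1/3) * L2_norm w'
        + (\<nu> * (of_int k)\<^sup>2) powr (1/3) * L2_norm w
        + \<bar>of_int k\<bar> * L2_norm (\<lambda>y. of_real (y - lam) * w y)
        \<le> 70 * L2_norm F"
    by (simp add: \<kappa>_def)
qed

end
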